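(* Let $t\ge 0$, let $v\in\{2,\dots,J\}$, and let $n_1,\dots,n_v$ be non-negative integers with $n_v\ge 1$. Then $$P\big[\mathbf{N}(t)=(n_1,\dots,n_v,0,\dots,0)\big]=\sum_{i_1=0}^{n_1}\cdots\sum_{i_{v-1}=0}^{n_{v-1}}\ \sum_{i_v=1}^{n_v}\Big[\frac{i_v}{n_v}\,P\big[\mathbf{N}(t)=(n_1-i_1,\dots,n_v-i_v,0,\dots,0)\big]\int_0^t\lambda(\tau)\,P\big[\mathbf{C}(t-\tau)=(i_1,\dots,i_v,0,\dots,0)\big]\,d\tau\Big].$$
   Context: Consider an open network of $J$ infinite server queues, indexed $1,\dots,J$, empty at time $0$. Batches arrive at the points $T_1,T_2,\dots$ of a non-homogeneous Poisson process on $[0,\infty)$ with rate function $\lambda(t)\ge 0$ (measurable, with $\int_0^t\lambda(\tau)\,d\tau<\infty$ for all $t$). At time $T_i$, $\Sigma_{ij}$ customers arrive at queue $j$, for $j=1,\dots,J$. The vectors $\mathbf{\Sigma}_i=(\Sigma_{i1},\dots,\Sigma_{iJ})$, with non-negative integer components, are i.i.d. (and independent of the arrival times), with the same distribution as a generic vector $\mathbf{S}=(S_1,\dots,S_J)$. The $\ell$th customer entering queue $j$ at time $T_i$ carries a stochastic process $X^j_{i,\ell}(t)$, $t\ge 0$, where $X^j_{i,\ell}(t)=k\in\{1,\dots,J\}$ means that the customer is in queue $k$ at time $T_i+t$ (and $X^j_{i,\ell}(t)\notin\{1,\dots,J\}$ if the customer has left the network). These processes are mutually independent and independent of the arrival times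 and batch sizes (conditionally on the node of entry), with $P(X^j_{i,\ell}(t)=k)=q^j_k(t)$ (measurable in $t$). $\mathbf{N}(t)=(N_1(t),\dots,N_J(t))$, where $N_k(t)$ is the number of customers in queue $k$ at time $t$. $\mathbf{C}_i(t)=(C_{i,1}(t),\dots,C_{i,J}(t))$ with $C_{i,k}(t)=\sum_{j=1}^J\sum_{\ell=1}^{\Sigma_{ij}}\mathbf{1}\{X^j_{i,\ell}(t)=k\}$ is the vector of numbers of customers of the $i$th batch that are in each queue at time $T_i+t$; its distribution does not depend on $i$, and $\mathbf{C}(t)$ denotes a generic random vector with this distribution. In the vectors $(\cdot,\dots,\cdot,0,\dots,0)$, entries $v+1,\dots,J$ are zero.
   Formalization: Each customer process is assumed jointly measurable in time and outcome with respect to its own sigma-algebra (true for right-continuous paths); without this the independence from the arrival times does not control the state at the random time t − T_i and the identity can fail. *)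

theory Defs
  imports "HOL-Probability.Probability"
begin

text \<open>
  Batches \<open>i\<close>, queues \<open>j, k\<close> and customers \<open>l\<close> of a batch are numbered from 1, so the value at
  index 0 of a family indexed by \<open>nat\<close> is irrelevant.  The arrival epochs take values in
  \<open>ereal\<close>: if there are fewer than \<open>i\<close> arrivals in all, then \<open>T i \<omega> = \<infinity>\<close>.
\<close>

definition arrival_count :: "(nat \<Rightarrow> 'a \<Rightarrow> ereal) \<Rightarrow> real \<Rightarrow> 'a \<Rightarrow> nat" where
  "arrival_count T t \<omega> = card {i. 1 \<le> i \<and> T i \<omega> \<le> ereal t}"

locale nonhomogeneous_poisson_arrivals = prob_space M
  for M :: "'a measure" and lam :: "real \<Rightarrow> real" and T :: "nat \<Rightarrow> 'a \<Rightarrow> ereal" +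
  assumes rate_nonneg: "\<And>t. 0 \<le> t \<Longrightarrow> 0 \<le> lam t"
    and rate_measurable: "lam \<in> borel_measurable (restrict_space borel {0..})"
    and rate_locally_integrable: "\<And>t. 0 \<le> t \<Longrightarrow> set_integrable lborel {0..t} lam"
    and epoch_measurable: "\<And>i. 1 \<le> i \<Longrightarrow> T i \<in> borel_measurable M"
    and epoch_nonneg: "\<And>i \<omega>. 1 \<le> i \<Longrightarrow> \<omega> \<in> space M \<Longrightarrow> 0 \<le> T i \<omega>"
    and epoch_mono: "\<And>i \<omega>. 1 \<le> i \<Longrightarrow> \<omega> \<in> space M \<Longrightarrow> T i \<omega> \<le> T (Suc i) \<omega>"
    and epoch_locally_finite:
      "\<And>t \<omega>. \<omega> \<in> space M \<Longrightarrow> finite {i. 1 \<le> i \<and> T i \<omega> \<le> ereal t}"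
    and count_zero: "AE \<omega> in M. arrival_count T 0 \<omega> = 0"
    and count_increment: "\<And>s t n. 0 \<le> s \<Longrightarrow> s \<le> t \<Longrightarrow>
      \<P>(\<omega> in M. arrival_count T t \<omega> - arrival_count T s \<omega> = n)
        = exp (- (LBINT u:{s..t}. lam u)) * (LBINT u:{s..t}. lam u) ^ n / fact n"
    and count_indep_increments: "\<And>u :: nat \<Rightarrow> real. 0 \<le> u 0 \<Longrightarrow> mono u \<Longrightarrow>
      indep_vars (\<lambda>_. count_space UNIV)
        (\<lambda>r \<omega>. arrival_count T (u (Suc r)) \<omega> - arrival_count T (u r) \<omega>) UNIV"

definition arrival_events :: "'a measure \<Rightarrow> (nat \<Rightarrow> 'a \<Rightarrow> ereal) \<Rightarrow> 'a measure" where
  "arrival_events M T =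
     vimage_algebra (space M) (\<lambda>\<omega>. \<lambda>i\<in>{1..}. T i \<omega>) (\<Pi>\<^sub>M i\<in>{1..}. borel)"

definition batch_events :: "'a measure \<Rightarrow> nat \<Rightarrow> (nat \<Rightarrow> 'a \<Rightarrow> nat) \<Rightarrow> 'a measure" where
  "batch_events M J B =
     vimage_algebra (space M) (\<lambda>\<omega>. \<lambda>j\<in>{1..J}. B j \<omega>) (\<Pi>\<^sub>M j\<in>{1..J}. count_space UNIV)"

definition path_events :: "'a measure \<Rightarrow> (real \<Rightarrow> 'a \<Rightarrow> nat) \<Rightarrow> 'a measure" where
  "path_events M Y =
     vimage_algebra (space M) (\<lambda>\<omega>. \<lambda>t\<in>{0..}. Y t \<omega>) (\<Pi>\<^sub>M t\<in>{0..}. count_space UNIV)"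

datatype source = Arrivals | Batch nat | Customer nat nat nat

text \<open>
  \<open>Sig i j\<close> is the number of customers of batch \<open>i\<close> entering queue \<open>j\<close>, and \<open>X j i l t\<close> is the
  queue occupied by customer \<open>l\<close> of batch \<open>i\<close> that entered queue \<open>j\<close>, \<open>t\<close> time units after entry;
  a value outside \<open>{1..J}\<close> means that the customer has left.  The processes are
  defined for all \<open>l \<ge> 1\<close>, although only those with \<open>l \<le> Sig i j\<close> belong to actual customers.

  Evaluating \<open>X j i l\<close> at the random time \<open>t - T i\<close> requires joint measurability in time and
  sample point.  It is required with respect to the process's own \<open>\<sigma>\<close>-algebra (as holds, for
  instance, for right-continuous paths): joint measurability with respect to \<open>M\<close> alone would not make
  independence of the family \<open>(X j i l t)\<close> (\<open>t \<ge> 0\<close>) from \<open>T\<close> meaningful at random times, as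
  \<open>X t = (if t = U then 1 else 0)\<close> with a continuously distributed \<open>U\<close> shows: this family is
  independent of \<open>U\<close> itself.
\<close>

locale infinite_server_network = nonhomogeneous_poisson_arrivals M lam T
  for M :: "'a measure" and lam :: "real \<Rightarrow> real" and T :: "nat \<Rightarrow> 'a \<Rightarrow> ereal" +
  fixes J :: nat
    and S :: "nat \<Rightarrow> 'a \<Rightarrow> nat"
    and Sig :: "nat \<Rightarrow> nat \<Rightarrow> 'a \<Rightarrow> nat"
    and X :: "nat \<Rightarrow> nat \<Rightarrow> nat \<Rightarrow> real \<Rightarrow> 'a \<Rightarrow> nat"
    and q :: "nat \<Rightarrow> nat \<Rightarrow> real \<Rightarrow> real"
  assumes generic_batch_measurable: "\<And>j. j \<in> {1..J} \<Longrightarrow> S j \<in> measurable M (count_space UNIV)"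
    and batch_measurable:
      "\<And>i j. 1 \<le> i \<Longrightarrow> j \<in> {1..J} \<Longrightarrow> Sig i j \<in> measurable M (count_space UNIV)"
    and batch_distr: "\<And>i. 1 \<le> i \<Longrightarrow>
      distr M (\<Pi>\<^sub>M j\<in>{1..J}. count_space UNIV) (\<lambda>\<omega>. \<lambda>j\<in>{1..J}. Sig i j \<omega>)
        = distr M (\<Pi>\<^sub>M j\<in>{1..J}. count_space UNIV) (\<lambda>\<omega>. \<lambda>j\<in>{1..J}. S j \<omega>)"
    and path_measurable: "\<And>i j l t. 1 \<le> i \<Longrightarrow> j \<in> {1..J} \<Longrightarrow> 1 \<le> l \<Longrightarrow> 0 \<le> t \<Longrightarrow>
      X j i l t \<in> measurable M (count_space UNIV)"
    and path_jointly_measurable: "\<And>i j l. 1 \<le> i \<Longrightarrow> j \<in> {1..J} \<Longrightarrow> 1 \<le> l \<Longrightarrow>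
      (\<lambda>(t, \<omega>). X j i l t \<omega>) \<in>
        measurable (restrict_space borel {0..} \<Otimes>\<^sub>M path_events M (X j i l)) (count_space UNIV)"
    and occupancy_measurable: "\<And>j k. j \<in> {1..J} \<Longrightarrow> k \<in> {1..J} \<Longrightarrow>
      q j k \<in> borel_measurable (restrict_space borel {0..})"
    and occupancy: "\<And>i j l k t. 1 \<le> i \<Longrightarrow> j \<in> {1..J} \<Longrightarrow> 1 \<le> l \<Longrightarrow> k \<in> {1..J} \<Longrightarrow> 0 \<le> t \<Longrightarrow>
      \<P>(\<omega> in M. X j i l t \<omega> = k) = q j k t"
    and independence: "indep_sets
      (\<lambda>c. case c of
          Arrivals \<Rightarrow> sets (arrival_events M T)
        | Batch i \<Rightarrow> sets (batch_events M J (Sig i))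
        | Customer j i l \<Rightarrow> sets (path_events M (X j i l)))
      ({Arrivals} \<union> {Batch i | i. 1 \<le> i}
        \<union> {Customer j i l | j i l. j \<in> {1..J} \<and> 1 \<le> i \<and> 1 \<le> l})"

definition queue_count ::
  "nat \<Rightarrow> (nat \<Rightarrow> 'a \<Rightarrow> ereal) \<Rightarrow> (nat \<Rightarrow> nat \<Rightarrow> 'a \<Rightarrow> nat)
    \<Rightarrow> (nat \<Rightarrow> nat \<Rightarrow> nat \<Rightarrow> real \<Rightarrow> 'a \<Rightarrow> nat) \<Rightarrow> nat \<Rightarrow> real \<Rightarrow> 'a \<Rightarrow> nat" where
  "queue_count J T Sig X k t \<omega> =
     card {(i, j, l). 1 \<le> i \<and> T i \<omega> \<le> ereal t \<and> j \<in> {1..J} \<and> l \<in> {1..Sig i j \<omega>} \<and>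
             X j i l (t - real_of_ereal (T i \<omega>)) \<omega> = k}"

definition batch_queue_count ::
  "nat \<Rightarrow> (nat \<Rightarrow> nat \<Rightarrow> 'a \<Rightarrow> nat) \<Rightarrow> (nat \<Rightarrow> nat \<Rightarrow> nat \<Rightarrow> real \<Rightarrow> 'a \<Rightarrow> nat)
    \<Rightarrow> nat \<Rightarrow> nat \<Rightarrow> real \<Rightarrow> 'a \<Rightarrow> nat" where
  "batch_queue_count J Sig X i k t \<omega> =
     (\<Sum>j=1..J. \<Sum>l=1..Sig i j \<omega>. of_bool (X j i l t \<omega> = k))"

text \<open>The vector \<open>(x\<^sub>1, \<dots>, x\<^sub>v, 0, \<dots>, 0)\<close>.\<close>
definition zero_pad :: "nat \<Rightarrow> (nat \<Rightarrow> nat) \<Rightarrow> nat \<Rightarrow> nat" where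
  "zero_pad v x k = (if k \<le> v then x k else 0)"

end

theory Submission
  imports Defs
begin

text \<open>
  The recursion comes from weighting the event that the population is \<open>n\<close> by the number of customers
  in queue \<open>v\<close>.  Every customer present belongs to exactly one batch, so on this event \<open>n\<^sub>v\<close> is the sum
  over the arrived batches of the batch's share \<open>c\<^sub>v\<close> of queue \<open>v\<close>, where \<open>c\<close> is the vector of the numbers of
  its members in the queues.  Hence \<open>n\<^sub>v P(N(t) = n)\<close> is the expected sum, over the arrived batches
  and over the vectors \<open>c \<le> n\<close>, of \<open>c\<^sub>v\<close> times the indicator that this batch contributes \<open>c\<close> and all others
  together contribute \<open>n - c\<close>.

  Two facts evaluate this expectation.  Given the arrival epochs, the batches evolve independently
  and the law of a batch of given age does not depend on its number, so the batches other than a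
  chosen one behave like the population of a network whose epochs are the given ones with one
  deleted (\<open>population_law_recursion\<close>).  And deleting a point from a Poisson process leaves, on
  average, the same process: by the Mecke formula (\<open>mecke_formula\<close>) the expected sum over the arrivals
  in \<open>[0, t]\<close> of \<open>f\<close> of the epoch times \<open>H\<close> of the remaining epochs is \<open>\<integral>\<^sub>0\<^sup>t \<lambda> f\<close> times the expectation of
  \<open>H\<close> of all epochs.  Together they give
  \<open>n\<^sub>v P(N(t) = n) = \<Sum>\<^sub>c c\<^sub>v P(N(t) = n - c) \<integral>\<^sub>0\<^sup>t \<lambda>(\<tau>) P(C(t - \<tau>) = c) d\<tau>\<close>.

  The Mecke formula rests on the one-dimensional identity \<open>d p(d) = l p(d - 1)\<close> for the Poisson weights
  with mean \<open>l\<close>.  Applied to one block of a partition of the time axis, with the independent other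
  blocks as parameters, it yields the formula for events in terms of the block counts
  (\<open>removed_counts_expectation\<close>), and these determine both sides as measures.  Conditioning on the epochs
  is justified by the independence of the arrivals from everything else, which turns the
  probability of \<open>N(t) = n\<close> into an integral over the epochs (\<open>emeasure_queue_count\<close>).

  Sequences of epochs and of batches are numbered from 0 below, so entry \<open>i\<close> is batch \<open>Suc i\<close>.
\<close>

section \<open>Measurability and independence\<close>

lemma measurable_count_space_sum:
  fixes f :: "'i \<Rightarrow> 'b \<Rightarrow> nat"
  assumes "\<And>i. i \<in> I \<Longrightarrow> f i \<in> measurable N (count_space UNIV)"
  shows "(\<lambda>x. \<Sum>i\<in>I. f i x) \<in> measurable N (count_space UNIV)"
  using assms
proof (induction I rule: infinite_finite_induct)
  case (insert i I)
  then have [measurable]: "f i \<in> measurable N (count_space UNIV)" "(\<lambda>x. \<Sum>i\<in>I. f i x) \<in> measurable N (count_space UNIV)"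
    by auto
  show ?case using insert.hyps by simp
qed auto

lemma measurable_pair_count_space:
  fixes f :: "'i :: countable \<Rightarrow> 'b \<Rightarrow> 'c"
  assumes f: "\<And>j. f j \<in> measurable N K"
  shows "(\<lambda>(x, j). f j x) \<in> measurable (N \<Otimes>\<^sub>M count_space UNIV) K"
  unfolding case_prod_beta'
  by (rule measurable_compose_countable[where f="\<lambda>j y. f j (fst y)"]) (auto intro: measurable_compose[OF _ f])

lemma measurable_component2:
  assumes "c \<in> I" "k \<in> K"
  shows "(\<lambda>y. y c k) \<in> measurable (\<Pi>\<^sub>M c\<in>I. \<Pi>\<^sub>M k\<in>K. count_space UNIV) (count_space UNIV)"
  using measurable_compose[OF measurable_component_singleton[OF assms(1)] measurable_component_singleton[OF assms(2)]] .

text \<open>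
  The pair may consist of variables of different types, for which the predicate
  \<open>indep_var\<close> is not available.
\<close>
lemma (in prob_space) distr_pair_indep:
  assumes X [measurable]: "X \<in> measurable M A" and Y [measurable]: "Y \<in> measurable M B"
    and indep: "\<And>a b. a \<in> sets A \<Longrightarrow> b \<in> sets B \<Longrightarrow>
      prob {\<omega> \<in> space M. X \<omega> \<in> a \<and> Y \<omega> \<in> b} = prob {\<omega> \<in> space M. X \<omega> \<in> a} * prob {\<omega> \<in> space M. Y \<omega> \<in> b}"
  shows "distr M (A \<Otimes>\<^sub>M B) (\<lambda>\<omega>. (X \<omega>, Y \<omega>)) = distr M A X \<Otimes>\<^sub>M distr M B Y"
proof (rule pair_measure_eqI[symmetric])
  fix a b assume "a \<in> sets (distr M A X)" "b \<in> sets (distr M B Y)"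
  then have [measurable]: "a \<in> sets A" "b \<in> sets B" by simp_all
  have "emeasure (distr M (A \<Otimes>\<^sub>M B) (\<lambda>\<omega>. (X \<omega>, Y \<omega>))) (a \<times> b) = emeasure M {\<omega> \<in> space M. X \<omega> \<in> a \<and> Y \<omega> \<in> b}"
    by (subst emeasure_distr) (auto intro!: arg_cong[where f="emeasure M"])
  also have "\<dots> = emeasure M {\<omega> \<in> space M. X \<omega> \<in> a} * emeasure M {\<omega> \<in> space M. Y \<omega> \<in> b}"
    by (simp add: emeasure_eq_measure indep ennreal_mult'')
  also have "\<dots> = emeasure (distr M A X) a * emeasure (distr M B Y) b"
    by (subst (1 2) emeasure_distr) (auto intro!: arg_cong2[where f="(*)"] arg_cong[where f="emeasure M"])
  finally show "emeasure (distr M A X) a * emeasure (distr M B Y) b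
    = emeasure (distr M (A \<Otimes>\<^sub>M B) (\<lambda>\<omega>. (X \<omega>, Y \<omega>))) (a \<times> b)" by simp
qed (auto intro!: prob_space_imp_sigma_finite prob_space_distr)


text \<open>
  The Poisson weights satisfy \<open>d p(d) = l p(d - 1)\<close>: weighting by the count has the effect of
  multiplying by the mean and adding one point.
\<close>
lemma (in prob_space) poisson_size_bias:
  fixes D :: "'a \<Rightarrow> nat" and h :: "nat \<Rightarrow> 'b \<Rightarrow> ennreal"
  assumes D [measurable]: "D \<in> measurable M (count_space UNIV)" and Z [measurable]: "Z \<in> measurable M N"
    and indep: "distr M (count_space UNIV \<Otimes>\<^sub>M N) (\<lambda>\<omega>. (D \<omega>, Z \<omega>)) = distr M (count_space UNIV) D \<Otimes>\<^sub>M distr M N Z"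
    and law: "\<And>d. prob {\<omega> \<in> space M. D \<omega> = d} = exp (- l) * l ^ d / fact d"
    and "0 \<le> l"
    and h: "(\<lambda>(d, z). h d z) \<in> borel_measurable (count_space UNIV \<Otimes>\<^sub>M N)"
  shows "(\<integral>\<^sup>+\<omega>. of_nat (D \<omega>) * h (D \<omega> - 1) (Z \<omega>) \<partial>M) = ennreal l * (\<integral>\<^sup>+\<omega>. h (D \<omega>) (Z \<omega>) \<partial>M)"
proof -
  let ?p = "\<lambda>d. ennreal (exp (- l) * l ^ d / fact d)"
  have h' [measurable]: "h d \<in> borel_measurable N" for d
    using measurable_compose[OF measurable_Pair1' h, of d] by simp
  have distr_D: "distr M (count_space UNIV) D = density (count_space UNIV) ?p"
  proof (rule measure_eqI_countable[of _ UNIV])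
    fix d :: nat
    have "emeasure (distr M (count_space UNIV) D) {d} = emeasure M {\<omega> \<in> space M. D \<omega> = d}"
      by (subst emeasure_distr) (auto intro!: arg_cong[where f="emeasure M"])
    also have "\<dots> = ?p d" by (simp add: emeasure_eq_measure law)
    also have "\<dots> = emeasure (density (count_space UNIV) ?p) {d}"
      by (subst emeasure_density) (auto simp: nn_integral_count_space_indicator[symmetric])
    finally show "emeasure (distr M (count_space UNIV) D) {d} = emeasure (density (count_space UNIV) ?p) {d}" .
  qed auto
  interpret DZ: pair_prob_space "distr M (count_space UNIV) D" "distr M N Z"
    by (simp add: pair_prob_space_def pair_sigma_finite_def prob_space_distr prob_space_imp_sigma_finite)
  have joint: "(\<integral>\<^sup>+\<omega>. g (D \<omega>) (Z \<omega>) \<partial>M) = (\<Sum>d. ?p d * (\<integral>\<^sup>+\<omega>. g d (Z \<omega>) \<partial>M))"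
    if g [measurable]: "(\<lambda>(d, z). g d z) \<in> borel_measurable (count_space UNIV \<Otimes>\<^sub>M N)" for g :: "nat \<Rightarrow> 'b \<Rightarrow> ennreal"
  proof -
    have g' [measurable]: "g d \<in> borel_measurable N" for d
      using measurable_compose[OF measurable_Pair1' g, of d] by simp
    have "(\<integral>\<^sup>+\<omega>. g (D \<omega>) (Z \<omega>) \<partial>M)
        = (\<integral>\<^sup>+(d, z). g d z \<partial>distr M (count_space UNIV \<Otimes>\<^sub>M N) (\<lambda>\<omega>. (D \<omega>, Z \<omega>)))"
      by (subst nn_integral_distr) auto
    also have "\<dots> = (\<integral>\<^sup>+(d, z). g d z \<partial>(distr M (count_space UNIV) D \<Otimes>\<^sub>M distr M N Z))"
      by (simp add: indep)
    also have "\<dots> = (\<integral>\<^sup>+d. \<integral>\<^sup>+z. g d z \<partial>distr M N Z \<partial>distr M (count_space UNIV) D)"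
      by (subst DZ.M2.nn_integral_fst[symmetric]) auto
    also have "\<dots> = (\<integral>\<^sup>+d. \<integral>\<^sup>+\<omega>. g d (Z \<omega>) \<partial>M \<partial>distr M (count_space UNIV) D)"
      by (simp add: nn_integral_distr)
    also have "\<dots> = (\<Sum>d. ?p d * (\<integral>\<^sup>+\<omega>. g d (Z \<omega>) \<partial>M))"
      unfolding distr_D by (subst nn_integral_density) (auto simp: nn_integral_count_space_nat)
    finally show ?thesis .
  qed
  have step: "?p (Suc d) * of_nat (Suc d) = ennreal l * ?p d" for d
  proof -
    have "exp (- l) * l ^ Suc d / fact (Suc d) * real (Suc d) = l * (exp (- l) * l ^ d / fact d)"
      by (simp add: divide_simps del: of_nat_Suc)
    then show ?thesis
      using \<open>0 \<le> l\<close> by (simp add: ennreal_of_nat_eq_real_of_nat ennreal_mult''[symmetric] ennreal_mult'[symmetric] del: of_nat_Suc fact_Suc)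
  qed
  have "(\<integral>\<^sup>+\<omega>. of_nat (D \<omega>) * h (D \<omega> - 1) (Z \<omega>) \<partial>M)
      = (\<Sum>d. ?p d * (\<integral>\<^sup>+\<omega>. of_nat d * h (d - 1) (Z \<omega>) \<partial>M))"
  proof (rule joint)
    have "(\<lambda>x. of_nat (fst x) * h (fst x - 1) (snd x)) \<in> borel_measurable (count_space UNIV \<Otimes>\<^sub>M N)"
      using measurable_compose[OF _ h, of "\<lambda>x. (fst x - 1, snd x)" "count_space UNIV \<Otimes>\<^sub>M N"] by simp
    then show "(\<lambda>(d, z). of_nat d * h (d - 1) z) \<in> borel_measurable (count_space UNIV \<Otimes>\<^sub>M N)"
      by (simp add: case_prod_beta')
  qed
  also have "\<dots> = (\<Sum>d. ?p d * (of_nat d * (\<integral>\<^sup>+\<omega>. h (d - 1) (Z \<omega>) \<partial>M)))"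
    by (simp add: nn_integral_cmult)
  also have "\<dots> = (\<Sum>d. ?p (Suc d) * (of_nat (Suc d) * (\<integral>\<^sup>+\<omega>. h d (Z \<omega>) \<partial>M)))"
    by (subst suminf_offset[of _ 1]) auto
  also have "\<dots> = (\<Sum>d. ennreal l * (?p d * (\<integral>\<^sup>+\<omega>. h d (Z \<omega>) \<partial>M)))"
    by (simp only: mult.assoc[symmetric] step)
  also have "\<dots> = ennreal l * (\<integral>\<^sup>+\<omega>. h (D \<omega>) (Z \<omega>) \<partial>M)"
    by (subst joint[OF h]) simp
  finally show ?thesis .
qed

section \<open>Deleting an entry of a sequence and counting\<close>

text \<open>
  The increasing enumeration of all indices except \<open>i\<close>: \<open>x \<circ> gap i\<close> is the sequence \<open>x\<close> with entry \<open>i\<close>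
  deleted.
\<close>
definition gap :: "nat \<Rightarrow> nat \<Rightarrow> nat" where
  "gap i k = (if k < i then k else Suc k)"

lemma bij_betw_gap: "j < m \<Longrightarrow> bij_betw (gap j) {..<m - 1} ({..<m} - {j})"
  by (rule bij_betwI[where g="\<lambda>i. if i < j then i else i - 1"]) (auto simp: gap_def split: if_splits)

text \<open>
  Here \<open>a s\<close> is the number of arrivals up to the \<open>s\<close>th partition point and \<open>d r\<close> the number in block \<open>r\<close>.
  Deleting the arrival \<open>j\<close> lowers exactly the cumulative counts that include it, which amounts to lowering
  the count of its own block by one; so the arrivals of a block, \<open>d r\<close> in number, all contribute the
  same term.
\<close>
lemma count_remove_arrival:
  fixes a :: "nat \<Rightarrow> nat" and d :: "nat \<Rightarrow> nat"
  assumes a0: "a 0 = 0" and a: "mono a"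
  defines "d \<equiv> \<lambda>r. a (Suc r) - a r"
  shows "(\<Sum>j<a m. G (\<lambda>s. a s - of_bool (j < a s)))
       = (\<Sum>r<m. of_nat (d r) * (G (\<lambda>s. \<Sum>r'<s. (d(r := d r - 1)) r') :: ennreal))"
proof (induction m)
  case 0
  then show ?case by (simp add: a0)
next
  case (Suc m)
  have sum_d: "(\<Sum>r<s. d r) = a s" for s
    by (induction s) (use a0 monoD[OF a, of s "Suc s" for s] in \<open>auto simp: d_def\<close>)
  have upd: "a s - of_bool (j < a s) = (\<Sum>r<s. (d(m := d m - 1)) r)"
    if j: "a m \<le> j" "j < a (Suc m)" for j s
  proof (cases "m < s")
    case True
    then have "a (Suc m) \<le> a s" by (intro monoD[OF a]) simp
    moreover have "(\<Sum>r<s. (d(m := d m - 1)) r) = (\<Sum>r<s. d r) - 1"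
    proof -
      have "(\<Sum>r<s. (d(m := d m - 1)) r) = (d m - 1) + (\<Sum>r\<in>{..<s}-{m}. d r)"
        using True by (subst sum.remove[of _ m]) auto
      moreover have "(\<Sum>r<s. d r) = d m + (\<Sum>r\<in>{..<s}-{m}. d r)"
        using True by (subst sum.remove[of _ m]) auto
      moreover have "d m \<ge> 1" using j by (simp add: d_def)
      ultimately show ?thesis by simp
    qed
    ultimately show ?thesis using j by (simp add: sum_d)
  next
    case False
    then have "a s \<le> a m" by (intro monoD[OF a]) simp
    moreover have "(\<Sum>r<s. (d(m := d m - 1)) r) = (\<Sum>r<s. d r)"
      using False by (intro sum.cong) auto
    ultimately show ?thesis using j by (simp add: sum_d)
  qed
  have "{..<a (Suc m)} = {..<a m} \<union> {a m..<a (Suc m)}"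
    using monoD[OF a, of m "Suc m"] by auto
  then have "(\<Sum>j<a (Suc m). G (\<lambda>s. a s - of_bool (j < a s)))
     = (\<Sum>j<a m. G (\<lambda>s. a s - of_bool (j < a s))) + (\<Sum>j=a m..<a (Suc m). G (\<lambda>s. a s - of_bool (j < a s)))"
    by (simp add: sum.union_disjoint ivl_disj_int)
  also have "(\<Sum>j=a m..<a (Suc m). G (\<lambda>s. a s - of_bool (j < a s)))
     = (\<Sum>j=a m..<a (Suc m). G (\<lambda>s. \<Sum>r'<s. (d(m := d m - 1)) r'))"
    by (intro sum.cong refl arg_cong[where f=G] ext upd) auto
  also have "\<dots> = of_nat (d m) * G (\<lambda>s. \<Sum>r'<s. (d(m := d m - 1)) r')"
    by (simp add: d_def)
  finally show ?case using Suc.IH by simp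
qed

text \<open>
  Finitely many times become the points of a partition; the enumeration is constant from the
  maximum on, so that it is defined on all of \<open>nat\<close> as a family of increments requires.
\<close>
lemma finite_set_mono_enumeration:
  fixes U :: "real set"
  assumes "finite U" "U \<noteq> {}"
  obtains x :: "nat \<Rightarrow> real" where "mono x" "U = range x" "x 0 = Min U"
proof
  let ?l = "sorted_list_of_set U"
  let ?x = "\<lambda>r. ?l ! min r (card U - 1)"
  have len: "length ?l = card U" "card U > 0" using assms by (auto simp: card_gt_0_iff)
  show "mono ?x"
    by (rule monoI, rule sorted_nth_mono) (use len in auto)
  show *: "U = range ?x"
  proof (intro equalityI subsetI)
    fix y assume "y \<in> U"
    then have "y \<in> set ?l" using assms by simp
    then obtain r where "r < card U" "y = ?l ! r" by (auto simp: in_set_conv_nth)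
    then have "min r (card U - 1) = r" "y = ?l ! r" by auto
    then have "y = ?x r" by metis
    then show "y \<in> range ?x" by blast
  next
    fix y assume "y \<in> range ?x"
    then obtain r where "y = ?x r" by blast
    then have "y \<in> set ?l" using len by (auto intro!: nth_mem)
    then show "y \<in> U" using assms by simp
  qed
  show "?x 0 = Min U"
  proof (rule Min_eqI[symmetric])
    fix y assume "y \<in> U"
    then obtain r where "y = ?x r" using * by blast
    then show "?x 0 \<le> y" using monoD[OF \<open>mono ?x\<close>, of 0 r] by simp
  next
    show "?x 0 \<in> U" using * by blast
  qed (fact assms)
qed

section \<open>Sequences of epochs\<close>

abbreviation seqs :: "(nat \<Rightarrow> ereal) measure" where
  "seqs \<equiv> \<Pi>\<^sub>M k\<in>(UNIV :: nat set). borel"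

text \<open>
  On these sets the condition on the epochs is a condition on the numbers of arrivals up to
  finitely many times.  They are closed under intersection and generate the product
  \<open>\<sigma>\<close>-algebra, so two finite measures that agree on them are equal.
\<close>
definition orthants :: "(real \<times> (nat \<Rightarrow> ereal)) set set" where
  "orthants = {{z. fst z \<le> b \<and> (\<forall>i\<in>F. snd z i \<le> u i)} | b F u. finite F}"

lemma orthantsI: "finite F \<Longrightarrow> {z. fst z \<le> b \<and> (\<forall>i\<in>F. snd z i \<le> u i)} \<in> orthants"
  by (auto simp: orthants_def)

lemma orthantsE:
  assumes "A \<in> orthants"
  obtains b F u where "finite F" "A = {z. fst z \<le> b \<and> (\<forall>i\<in>F. snd z i \<le> u i)}"
  using assms by (auto simp: orthants_def)

lemma sets_orthants: "sets (borel \<Otimes>\<^sub>M seqs) = sigma_sets UNIV orthants"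
proof
  have space: "space (sigma UNIV orthants) = UNIV" by (simp add: space_measure_of_conv)
  have gen: "{z. fst z \<le> b \<and> (\<forall>i\<in>F. snd z i \<le> u i)} \<in> sets (sigma UNIV orthants)" if "finite F" for b F and u :: "nat \<Rightarrow> ereal"
    by (subst sets_measure_of) (use orthantsI[OF that] in auto)
  have "(\<lambda>z. z) \<in> measurable (sigma UNIV orthants) (borel \<Otimes>\<^sub>M seqs)"
  proof (rule measurable_pair)
    show "fst \<circ> (\<lambda>z. z) \<in> borel_measurable (sigma UNIV orthants)"
      unfolding borel_measurable_iff_le space
    proof
      fix a :: real
      show "{w \<in> UNIV. (fst \<circ> (\<lambda>z. z)) w \<le> a} \<in> sets (sigma UNIV orthants)"
        using gen[of "{}" a] by simp
    qed
    show "snd \<circ> (\<lambda>z. z) \<in> measurable (sigma UNIV orthants) seqs"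
      unfolding comp_def
    proof (rule measurable_PiM_single'[where f="\<lambda>i z. snd z i"])
      fix i :: nat
      have "(\<lambda>z. snd z i) -` {..a} \<inter> space (sigma UNIV orthants) \<in> sets (sigma UNIV orthants)" for a
      proof -
        \<comment> \<open>Every generator bounds the first component, hence the countable union over its bounds.\<close>
        have "(\<lambda>z. snd z i) -` {..a} \<inter> space (sigma UNIV orthants)
          = (\<Union>n. {z. fst z \<le> real n \<and> (\<forall>j\<in>{i}. snd z j \<le> a)})"
          unfolding space by (auto simp: real_arch_simple)
        also have "\<dots> \<in> sets (sigma UNIV orthants)"
          by (intro sets.countable_UN) (use gen[of "{i}" _ "\<lambda>_. a"] in auto)
        finally show ?thesis .
      qed
      then show "(\<lambda>z. snd z i) \<in> borel_measurable (sigma UNIV orthants)"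
        by (simp add: borel_measurable_iff_Iic_ereal)
    qed (simp add: space)
  qed
  from measurable_sets[OF this]
  have "A \<in> sets (sigma UNIV orthants)" if "A \<in> sets (borel \<Otimes>\<^sub>M seqs)" for A
    using that by (simp add: space)
  then show "sets (borel \<Otimes>\<^sub>M seqs) \<subseteq> sigma_sets UNIV orthants" by auto
  have "{z \<in> space (borel \<Otimes>\<^sub>M seqs). fst z \<le> b \<and> (\<forall>i\<in>F. snd z i \<le> u i)} \<in> sets (borel \<Otimes>\<^sub>M seqs)"
    if [simp]: "finite F" for b :: real and F :: "nat set" and u :: "nat \<Rightarrow> ereal"
    by measurable
  moreover have "UNIV \<in> sets (borel \<Otimes>\<^sub>M seqs)"
    using sets.top[of "borel \<Otimes>\<^sub>M seqs"] by (simp add: space_pair_measure space_PiM)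
  ultimately show "sigma_sets UNIV orthants \<subseteq> sets (borel \<Otimes>\<^sub>M seqs)"
    by (intro sets.sigma_sets_subset') (auto simp: space_pair_measure space_PiM elim!: orthantsE)
qed

lemma Int_stable_orthants: "Int_stable orthants"
proof (rule Int_stableI)
  fix A B assume "A \<in> orthants" "B \<in> orthants"
  then obtain b F u b' F' u' where F: "finite F" "finite F'"
    and A: "A = {z. fst z \<le> b \<and> (\<forall>i\<in>F. snd z i \<le> u i)}" and B: "B = {z. fst z \<le> b' \<and> (\<forall>i\<in>F'. snd z i \<le> u' i)}"
    by (elim orthantsE)
  have "A \<inter> B = {z. fst z \<le> min b b' \<and> (\<forall>i\<in>F \<union> F'. snd z i \<le>
      (if i \<in> F then if i \<in> F' then min (u i) (u' i) else u i else u' i))}"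
    unfolding A B by (auto split: if_splits)
  also have "\<dots> \<in> orthants" using F by (intro orthantsI) simp
  finally show "A \<inter> B \<in> orthants" .
qed

section \<open>The Mecke formula for the arrivals\<close>

context nonhomogeneous_poisson_arrivals begin

definition epochs :: "'a \<Rightarrow> nat \<Rightarrow> ereal" where
  "epochs \<omega> k = T (Suc k) \<omega>"

lemma measurable_epochs [measurable]: "epochs \<in> measurable M seqs"
  unfolding epochs_def by (rule measurable_PiM_single') (auto intro: epoch_measurable)

lemma measurable_epoch [measurable]: "(\<lambda>\<omega>. epochs \<omega> k) \<in> borel_measurable M"
  unfolding epochs_def by (intro epoch_measurable) simp

lemma mono_epochs: "\<omega> \<in> space M \<Longrightarrow> mono (epochs \<omega>)"
  unfolding incseq_Suc_iff epochs_def by (auto intro: epoch_mono)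

text \<open>
  The epochs increase and only finitely many are at most \<open>u\<close>, so these are an initial
  segment whose length is the count.
\<close>
lemma epochs_le_iff:
  assumes "\<omega> \<in> space M"
  shows "epochs \<omega> k \<le> ereal u \<longleftrightarrow> k < arrival_count T u \<omega>"
proof -
  let ?A = "{k. epochs \<omega> k \<le> ereal u}"
  have "bij_betw Suc ?A {i. 1 \<le> i \<and> T i \<omega> \<le> ereal u}"
  proof (rule bij_betwI[of _ _ _ "\<lambda>i. i - 1"])
    show "Suc \<in> ?A \<rightarrow> {i. 1 \<le> i \<and> T i \<omega> \<le> ereal u}" by (simp add: epochs_def)
    show "(\<lambda>i. i - 1) \<in> {i. 1 \<le> i \<and> T i \<omega> \<le> ereal u} \<rightarrow> ?A" by (simp add: epochs_def)
  qed auto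
  then have fin: "finite ?A" and card: "card ?A = arrival_count T u \<omega>"
    using epoch_locally_finite[OF assms, of u] bij_betw_finite bij_betw_same_card
    unfolding arrival_count_def by blast+
  have down: "k \<in> ?A" if "k \<le> l" "l \<in> ?A" for k l
    using that monoD[OF mono_epochs[OF assms] that(1)] by auto
  have "?A = {..<card ?A}"
  proof (cases "?A = {}")
    case False
    then have "?A = {..Max ?A}" using fin down Max_in[OF fin False] by (auto intro: Max_ge)
    then show ?thesis by (metis card_atMost lessThan_Suc_atMost)
  qed auto
  then show ?thesis unfolding card by blast
qed

lemma mono_arrival_count:
  assumes "\<omega> \<in> space M" shows "mono (\<lambda>u. arrival_count T u \<omega>)"
proof
  fix s u :: real assume "s \<le> u"
  have "k < arrival_count T u \<omega>" if "k < arrival_count T s \<omega>" for k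
    using that \<open>s \<le> u\<close> order_trans[of "epochs \<omega> k" "ereal s" "ereal u"]
    by (simp add: epochs_le_iff[OF assms, symmetric])
  then show "arrival_count T s \<omega> \<le> arrival_count T u \<omega>" by (meson not_le less_irrefl)
qed

lemma measurable_arrival_count [measurable]:
  "arrival_count T u \<in> measurable M (count_space UNIV)"
proof (subst measurable_count_space_eq2_countable, safe)
  fix n
  have "arrival_count T u -` {n} \<inter> space M
      = {\<omega> \<in> space M. (\<forall>k<n. epochs \<omega> k \<le> ereal u) \<and> \<not> epochs \<omega> n \<le> ereal u}"
    by (auto simp: epochs_le_iff) (metis linorder_neqE_nat less_irrefl)
  also have "\<dots> \<in> sets M" by measurable
  finally show "arrival_count T u -` {n} \<inter> space M \<in> sets M" .
qed auto

text \<open>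
  The sequence without entry \<open>j\<close> is again increasing, and its count is one lower precisely where entry \<open>j\<close>
  had been counted.
\<close>
lemma remove_epoch_le_iff:
  assumes "\<omega> \<in> space M"
  shows "(epochs \<omega> \<circ> gap j) k \<le> ereal u
     \<longleftrightarrow> k < arrival_count T u \<omega> - of_bool (j < arrival_count T u \<omega>)"
  using assms by (auto simp: gap_def epochs_le_iff)

definition rate_measure :: "real \<Rightarrow> real measure" where
  "rate_measure t = density lborel (\<lambda>\<tau>. ennreal (indicator {0..t} \<tau> * lam \<tau>))"

lemma borel_measurable_rate [measurable]:
  "(\<lambda>\<tau>. indicator {0..t} \<tau> * lam \<tau>) \<in> borel_measurable borel"
proof (cases "0 \<le> t")
  case True
  then show ?thesis using rate_locally_integrable[of t]
    by (auto simp: set_integrable_def dest!: borel_measurable_integrable)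
qed auto

lemma rate_indicator_nonneg: "0 \<le> indicator {0..t} \<tau> * lam \<tau>"
  by (simp add: indicator_def rate_nonneg)

lemma rate_interval_integrable:
  "0 \<le> s \<Longrightarrow> set_integrable lborel {s..u} lam"
  by (cases "0 \<le> u") (auto intro: set_integrable_subset[OF rate_locally_integrable])

lemma rate_integral_nonneg: "0 \<le> s \<Longrightarrow> 0 \<le> (LBINT u:{s..t}. lam u)"
  unfolding set_lebesgue_integral_def
  by (intro Bochner_Integration.integral_nonneg) (auto simp: indicator_def rate_nonneg)

lemma rate_integral_telescope:
  assumes x: "mono x" "x 0 = (0::real)"
  shows "(\<Sum>r<m. LBINT u:{x r..x (Suc r)}. lam u) = (LBINT u:{0..x m}. lam u)"
proof (induction m)
  case 0
  have "(LBINT u:{0..0}. lam u) = 0"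
    unfolding set_lebesgue_integral_def
    by (rule integral_eq_zero_AE, rule AE_mp[OF AE_lborel_singleton[of 0]], rule AE_I2) simp
  then show ?case by (simp add: x)
next
  case (Suc m)
  have le: "0 \<le> x m" "x m \<le> x (Suc m)" using monoD[OF x(1), of 0 m] monoD[OF x(1), of m "Suc m"] x(2) by auto
  have "(LBINT u:{0..x m} \<union> {x m..x (Suc m)}. lam u)
      = (LBINT u:{0..x m}. lam u) + (LBINT u:{x m..x (Suc m)}. lam u)"
    using le AE_lborel_singleton[of "x m"]
    by (intro set_integral_Un_AE rate_interval_integrable) (auto elim: eventually_mono)
  also have "{0..x m} \<union> {x m..x (Suc m)} = {0..x (Suc m)}" using le by auto
  finally show ?case using Suc.IH by simp
qed

lemma emeasure_rate_measure_atMost: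
  assumes "0 \<le> b" "b \<le> t"
  shows "emeasure (rate_measure t) {..b} = ennreal (LBINT u:{0..b}. lam u)"
proof -
  have "emeasure (rate_measure t) {..b} = (\<integral>\<^sup>+\<tau>. ennreal (indicator {0..t} \<tau> * lam \<tau>) * indicator {..b} \<tau> \<partial>lborel)"
    unfolding rate_measure_def by (subst emeasure_density) auto
  also have "\<dots> = (\<integral>\<^sup>+\<tau>. ennreal (indicator {0..b} \<tau> * lam \<tau>) \<partial>lborel)"
    using assms by (intro nn_integral_cong) (auto simp: indicator_def)
  also have "\<dots> = ennreal (LBINT u:{0..b}. lam u)"
    unfolding set_lebesgue_integral_def using rate_locally_integrable[of b] assms
    by (subst nn_integral_eq_integral) (auto simp: set_integrable_def rate_indicator_nonneg)
  finally show ?thesis .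
qed

text \<open>
  The count of block \<open>r\<close> is Poisson and independent of the vector of all other counts, so
  \<open>poisson_size_bias\<close> applies with that vector as the parameter.
\<close>
lemma block_size_bias:
  assumes x: "mono x" "0 \<le> x 0"
    and h [measurable]: "h \<in> borel_measurable (\<Pi>\<^sub>M r\<in>(UNIV :: nat set). count_space (UNIV :: nat set))"
  defines "D \<equiv> \<lambda>\<omega> r. arrival_count T (x (Suc r)) \<omega> - arrival_count T (x r) \<omega>"
  shows "(\<integral>\<^sup>+\<omega>. of_nat (D \<omega> r) * h ((D \<omega>)(r := D \<omega> r - 1)) \<partial>M)
    = ennreal (LBINT u:{x r..x (Suc r)}. lam u) * (\<integral>\<^sup>+\<omega>. h (D \<omega>) \<partial>M)"
proof -
  let ?C = "\<lambda>_::nat. count_space (UNIV :: nat set)"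
  let ?N = "\<Pi>\<^sub>M r\<in>UNIV-{r}. count_space (UNIV :: nat set)"
  have D [measurable]: "(\<lambda>\<omega>. D \<omega> r) \<in> measurable M (count_space UNIV)" for r
    unfolding D_def by measurable
  have xr: "0 \<le> x r" "x r \<le> x (Suc r)" using monoD[OF x(1), of 0 r] monoD[OF x(1), of r "Suc r"] x(2) by auto
  have "indep_vars ?C (\<lambda>r \<omega>. D \<omega> r) UNIV"
    unfolding D_def using x by (intro count_indep_increments)
  then have ind: "indep_var (PiM {r} ?C) (\<lambda>\<omega>. \<lambda>r\<in>{r}. D \<omega> r) ?N (\<lambda>\<omega>. \<lambda>r\<in>UNIV-{r}. D \<omega> r)"
    by (rule indep_var_restrict) auto
  have pair: "distr M (count_space UNIV \<Otimes>\<^sub>M ?N) (\<lambda>\<omega>. (D \<omega> r, \<lambda>r\<in>UNIV-{r}. D \<omega> r))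
     = distr M (count_space UNIV) (\<lambda>\<omega>. D \<omega> r) \<Otimes>\<^sub>M distr M ?N (\<lambda>\<omega>. \<lambda>r\<in>UNIV-{r}. D \<omega> r)"
  proof (rule distr_pair_indep)
    fix a :: "nat set" and b assume b: "b \<in> sets ?N"
    have "(\<lambda>x. x r) -` a \<inter> space (PiM {r} ?C) \<in> sets (PiM {r} ?C)"
      by (rule measurable_sets[where A="count_space UNIV"]) (auto intro: measurable_component_singleton)
    from indep_varD[OF ind this b]
    show "prob {\<omega> \<in> space M. D \<omega> r \<in> a \<and> (\<lambda>r\<in>UNIV-{r}. D \<omega> r) \<in> b}
       = prob {\<omega> \<in> space M. D \<omega> r \<in> a} * prob {\<omega> \<in> space M. (\<lambda>r\<in>UNIV-{r}. D \<omega> r) \<in> b}"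
      by (simp add: vimage_def space_PiM Int_def conj_commute cong: conj_cong)
  qed measurable
  have eta: "(\<lambda>r\<in>UNIV-{r}. D \<omega> r)(r := d) = (D \<omega>)(r := d)" for \<omega> d by (auto simp: fun_eq_iff)
  have "(\<integral>\<^sup>+\<omega>. of_nat (D \<omega> r) * h ((\<lambda>r\<in>UNIV-{r}. D \<omega> r)(r := D \<omega> r - 1)) \<partial>M)
    = ennreal (LBINT u:{x r..x (Suc r)}. lam u) * (\<integral>\<^sup>+\<omega>. h ((\<lambda>r\<in>UNIV-{r}. D \<omega> r)(r := D \<omega> r)) \<partial>M)"
  proof (rule poisson_size_bias[OF _ _ pair, where h="\<lambda>d z. h (z(r := d))"])
    show "prob {\<omega> \<in> space M. D \<omega> r = d} = exp (- (LBINT u:{x r..x (Suc r)}. lam u)) * (LBINT u:{x r..x (Suc r)}. lam u) ^ d / fact d" for d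
      unfolding D_def using xr by (rule count_increment)
    show "(\<lambda>(d, z). h (z(r := d))) \<in> borel_measurable (count_space UNIV \<Otimes>\<^sub>M ?N)"
      unfolding case_prod_beta'
      by (rule measurable_compose[OF _ h], rule measurable_fun_upd[where J="UNIV-{r}"]) auto
  qed (auto simp: rate_integral_nonneg xr)
  then show ?thesis unfolding eta by simp
qed


text \<open>
  The Mecke formula on a single orthant, written in terms of counts.  A partition through \<open>0\<close>, \<open>b\<close>
  and all \<open>u i\<close> makes every count a sum of block counts; then the contribution of each block below \<open>b\<close>
  is evaluated by \<open>block_size_bias\<close>, and the rates of these blocks add up to \<open>\<integral>\<^sub>0\<^sup>b \<lambda>\<close>.
\<close>
lemma removed_counts_expectation:
  assumes F: "finite F" "\<And>i. i \<in> F \<Longrightarrow> 0 \<le> u i" and b: "0 \<le> b"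
  shows "(\<integral>\<^sup>+\<omega>. (\<Sum>j<arrival_count T b \<omega>.
        of_bool (\<forall>i\<in>F. i < arrival_count T (u i) \<omega> - of_bool (j < arrival_count T (u i) \<omega>))) \<partial>M)
    = ennreal (LBINT \<tau>:{0..b}. lam \<tau>) * emeasure M {\<omega> \<in> space M. \<forall>i\<in>F. i < arrival_count T (u i) \<omega>}"
proof -
  let ?U = "insert 0 (insert b (u ` F))"
  have fin: "finite ?U" using F(1) by simp
  obtain x :: "nat \<Rightarrow> real" where x: "mono x" "?U = range x" "x 0 = Min ?U"
    by (rule finite_set_mono_enumeration[OF fin insert_not_empty])
  have x0: "x 0 = 0"
    unfolding x(3) using F b by (intro Min_eqI) auto
  have "b \<in> range x" unfolding x(2)[symmetric] by auto
  then obtain m where m: "b = x m" by auto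
  have "\<forall>i\<in>F. \<exists>s. u i = x s" using x(2) by blast
  then obtain s where s: "\<And>i. i \<in> F \<Longrightarrow> u i = x (s i)" by metis
  define a where "a = (\<lambda>\<omega> r. arrival_count T (x r) \<omega>)"
  define D where "D = (\<lambda>\<omega> r. arrival_count T (x (Suc r)) \<omega> - arrival_count T (x r) \<omega>)"
  define G :: "(nat \<Rightarrow> nat) \<Rightarrow> ennreal" where "G = (\<lambda>w. of_bool (\<forall>i\<in>F. i < w (s i)))"
  define h where "h = (\<lambda>d. G (\<lambda>s. \<Sum>r<s. d r))"
  have h [measurable]: "h \<in> borel_measurable (\<Pi>\<^sub>M r\<in>(UNIV :: nat set). count_space (UNIV :: nat set))"
  proof -
    have [measurable]: "(\<lambda>d. \<Sum>r<k. d r) \<in> measurable (\<Pi>\<^sub>M r\<in>(UNIV :: nat set). count_space (UNIV :: nat set)) (count_space UNIV)" for k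
      by (intro measurable_count_space_sum) auto
    show ?thesis unfolding h_def G_def of_bool_def using F(1) by measurable
  qed
  have [measurable]: "D \<in> measurable M (\<Pi>\<^sub>M r\<in>(UNIV :: nat set). count_space (UNIV :: nat set))"
    unfolding D_def by (rule measurable_PiM_single') auto
  \<comment> \<open>An arrival at time 0 would belong to no block.\<close>
  have ae: "AE \<omega> in M. a \<omega> 0 = 0"
    using count_zero by (simp add: a_def x0)
  have mono_a: "mono (a \<omega>)" if "\<omega> \<in> space M" for \<omega>
    unfolding a_def using mono_arrival_count[OF that] x(1) by (auto simp: mono_def)
  have "(\<integral>\<^sup>+\<omega>. (\<Sum>j<arrival_count T b \<omega>.
        of_bool (\<forall>i\<in>F. i < arrival_count T (u i) \<omega> - of_bool (j < arrival_count T (u i) \<omega>))) \<partial>M)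
      = (\<integral>\<^sup>+\<omega>. (\<Sum>j<a \<omega> m. G (\<lambda>s. a \<omega> s - of_bool (j < a \<omega> s))) \<partial>M)"
    by (simp add: G_def a_def s m cong: ball_cong)
  also have "\<dots> = (\<integral>\<^sup>+\<omega>. (\<Sum>r<m. of_nat (D \<omega> r) * h ((D \<omega>)(r := D \<omega> r - 1))) \<partial>M)"
  proof (rule nn_integral_cong_AE, rule AE_mp[OF ae], intro AE_I2 impI)
    fix \<omega> assume w: "\<omega> \<in> space M" and 0: "a \<omega> 0 = 0"
    show "(\<Sum>j<a \<omega> m. G (\<lambda>s. a \<omega> s - of_bool (j < a \<omega> s))) = (\<Sum>r<m. of_nat (D \<omega> r) * h ((D \<omega>)(r := D \<omega> r - 1)))"
      using count_remove_arrival[of "a \<omega>" G m, OF 0 mono_a[OF w]] by (simp add: a_def D_def h_def)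
  qed
  also have "\<dots> = (\<Sum>r<m. \<integral>\<^sup>+\<omega>. of_nat (D \<omega> r) * h ((D \<omega>)(r := D \<omega> r - 1)) \<partial>M)"
  proof (rule nn_integral_sum)
    fix r
    have [measurable]: "(\<lambda>\<omega>. D \<omega> r) \<in> measurable M (count_space UNIV)" for r by (simp add: D_def)
    have "(\<lambda>\<omega>. (D \<omega>)(r := D \<omega> r - 1)) \<in> measurable M (\<Pi>\<^sub>M r\<in>(UNIV :: nat set). count_space (UNIV :: nat set))"
      by (rule measurable_fun_upd[where J=UNIV]) auto
    from measurable_compose[OF this h]
    show "(\<lambda>\<omega>. of_nat (D \<omega> r) * h ((D \<omega>)(r := D \<omega> r - 1))) \<in> borel_measurable M" by measurable
  qed
  also have "\<dots> = (\<Sum>r<m. ennreal (LBINT u:{x r..x (Suc r)}. lam u) * (\<integral>\<^sup>+\<omega>. h (D \<omega>) \<partial>M))"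
    unfolding D_def by (intro sum.cong refl block_size_bias[OF x(1) _ h]) (simp add: x0)
  also have "\<dots> = ennreal (\<Sum>r<m. LBINT u:{x r..x (Suc r)}. lam u) * (\<integral>\<^sup>+\<omega>. h (D \<omega>) \<partial>M)"
    using monoD[OF x(1), of 0] by (simp add: sum_distrib_right[symmetric] rate_integral_nonneg x0 sum_ennreal)
  also have "(\<Sum>r<m. LBINT u:{x r..x (Suc r)}. lam u) = (LBINT \<tau>:{0..b}. lam \<tau>)"
    unfolding m by (rule rate_integral_telescope[OF x(1) x0])
  also have "(\<integral>\<^sup>+\<omega>. h (D \<omega>) \<partial>M) = (\<integral>\<^sup>+\<omega>. indicator {\<omega> \<in> space M. \<forall>i\<in>F. i < arrival_count T (u i) \<omega>} \<omega> \<partial>M)"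
  proof (rule nn_integral_cong_AE, rule AE_mp[OF ae], intro AE_I2 impI)
    fix \<omega> assume w: "\<omega> \<in> space M" and 0: "a \<omega> 0 = 0"
    have "(\<Sum>r<k. D \<omega> r) = a \<omega> k" for k
      using 0 monoD[OF mono_a[OF w], of k "Suc k" for k]
      by (induction k) (auto simp: D_def a_def)
    then show "h (D \<omega>) = indicator {\<omega> \<in> space M. \<forall>i\<in>F. i < arrival_count T (u i) \<omega>} \<omega>"
      using w by (simp add: h_def G_def a_def s indicator_def cong: ball_cong)
  qed
  also have "\<dots> = emeasure M {\<omega> \<in> space M. \<forall>i\<in>F. i < arrival_count T (u i) \<omega>}"
    using F(1) by (intro nn_integral_indicator) measurable
  finally show ?thesis .
qed

lemma measurable_removed_epochs [measurable]:
  "(\<lambda>(\<omega>, j). (real_of_ereal (epochs \<omega> j), epochs \<omega> \<circ> gap j)) \<in> measurable (M \<Otimes>\<^sub>M count_space UNIV) (borel \<Otimes>\<^sub>M seqs)"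
proof (rule measurable_pair_count_space)
  fix j :: nat
  have [measurable]: "(\<lambda>\<omega>. epochs \<omega> \<circ> gap j) \<in> measurable M seqs"
    unfolding comp_def by (rule measurable_PiM_single') auto
  show "(\<lambda>\<omega>. (real_of_ereal (epochs \<omega> j), epochs \<omega> \<circ> gap j)) \<in> measurable M (borel \<Otimes>\<^sub>M seqs)"
    by simp
qed

text \<open>
  The reduced Campbell measure of the arrivals in \<open>[0, t]\<close>: the intensity of the pairs consisting of an
  epoch and the sequence of the other epochs.  The factor \<open>count_space UNIV\<close> sums over the index
  of the epoch.
\<close>
definition removal_measure :: "real \<Rightarrow> (real \<times> (nat \<Rightarrow> ereal)) measure" where
  "removal_measure t = distr
     (density (M \<Otimes>\<^sub>M count_space UNIV) (\<lambda>(\<omega>, j). indicator {..ereal t} (epochs \<omega> j)))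
     (borel \<Otimes>\<^sub>M seqs) (\<lambda>(\<omega>, j). (real_of_ereal (epochs \<omega> j), epochs \<omega> \<circ> gap j))"

lemma nn_integral_removal_measure:
  assumes f [measurable]: "(\<lambda>(\<tau>, x). f \<tau> x) \<in> borel_measurable (borel \<Otimes>\<^sub>M seqs)"
  shows "(\<integral>\<^sup>+(\<tau>, x). f \<tau> x \<partial>removal_measure t)
    = (\<integral>\<^sup>+\<omega>. (\<Sum>j<arrival_count T t \<omega>. f (real_of_ereal (epochs \<omega> j)) (epochs \<omega> \<circ> gap j)) \<partial>M)"
proof -
  interpret C: sigma_finite_measure "count_space (UNIV :: nat set)"
    by (rule sigma_finite_measure_count_space)
  have dens [measurable]: "(\<lambda>(\<omega>, j). indicator {..ereal t} (epochs \<omega> j) :: ennreal) \<in> borel_measurable (M \<Otimes>\<^sub>M count_space UNIV)"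
    by (rule measurable_pair_count_space) auto
  let ?g = "\<lambda>(\<omega>, j). f (real_of_ereal (epochs \<omega> j)) (epochs \<omega> \<circ> gap j)"
  have g [measurable]: "?g \<in> borel_measurable (M \<Otimes>\<^sub>M count_space UNIV)"
    using measurable_compose[OF measurable_removed_epochs f] by (simp add: case_prod_beta')
  have "(\<integral>\<^sup>+(\<tau>, x). f \<tau> x \<partial>removal_measure t)
    = (\<integral>\<^sup>+y. ?g y \<partial>density (M \<Otimes>\<^sub>M count_space UNIV) (\<lambda>(\<omega>, j). indicator {..ereal t} (epochs \<omega> j)))"
    unfolding removal_measure_def by (subst nn_integral_distr) (auto simp: case_prod_beta')
  also have "\<dots> = (\<integral>\<^sup>+y. (case y of (\<omega>, j) \<Rightarrow> indicator {..ereal t} (epochs \<omega> j)) * ?g y \<partial>(M \<Otimes>\<^sub>M count_space UNIV))"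
    by (rule nn_integral_density[OF dens g])
  also have "\<dots> = (\<integral>\<^sup>+\<omega>. \<integral>\<^sup>+j. indicator {..ereal t} (epochs \<omega> j) * f (real_of_ereal (epochs \<omega> j)) (epochs \<omega> \<circ> gap j) \<partial>count_space UNIV \<partial>M)"
    by (subst C.nn_integral_fst[symmetric]) auto
  also have "\<dots> = (\<integral>\<^sup>+\<omega>. (\<Sum>j<arrival_count T t \<omega>. f (real_of_ereal (epochs \<omega> j)) (epochs \<omega> \<circ> gap j)) \<partial>M)"
  proof (rule nn_integral_cong)
    fix \<omega> assume w: "\<omega> \<in> space M"
    have "(\<integral>\<^sup>+j. indicator {..ereal t} (epochs \<omega> j) * f (real_of_ereal (epochs \<omega> j)) (epochs \<omega> \<circ> gap j) \<partial>count_space UNIV)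
      = (\<Sum>j<arrival_count T t \<omega>. indicator {..ereal t} (epochs \<omega> j) * f (real_of_ereal (epochs \<omega> j)) (epochs \<omega> \<circ> gap j))"
      by (rule nn_integral_count_space') (auto simp: indicator_def epochs_le_iff[OF w])
    then show "(\<integral>\<^sup>+j. indicator {..ereal t} (epochs \<omega> j) * f (real_of_ereal (epochs \<omega> j)) (epochs \<omega> \<circ> gap j) \<partial>count_space UNIV)
      = (\<Sum>j<arrival_count T t \<omega>. f (real_of_ereal (epochs \<omega> j)) (epochs \<omega> \<circ> gap j))"
      by (simp add: indicator_def epochs_le_iff[OF w])
  qed
  finally show ?thesis .
qed


text \<open>
  Both sides are finite measures, so it suffices to compare them on orthants.  Those with a negative
  bound are null for both, infinite bounds impose no condition, and the remaining ones are covered by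
  \<open>removed_counts_expectation\<close>.
\<close>
lemma removal_measure_eq:
  assumes t: "0 \<le> t"
  shows "removal_measure t = rate_measure t \<Otimes>\<^sub>M distr M seqs epochs"
proof (rule measure_eqI_generator_eq[where E=orthants and \<Omega>=UNIV and A="\<lambda>n. {z. fst z \<le> real n \<and> (\<forall>i\<in>{}. snd z i \<le> 0)}"])
  interpret E: prob_space "distr M seqs epochs" by (intro prob_space_distr) measurable
  have rate_sets [simp, measurable_cong]: "sets (rate_measure t) = sets borel"
    by (simp add: rate_measure_def)
  have removal_sets [simp, measurable_cong]: "sets (removal_measure t) = sets (borel \<Otimes>\<^sub>M seqs)"
    by (simp add: removal_measure_def)
  have orthant_measurable [measurable]: "{z. fst z \<le> b \<and> (\<forall>i\<in>F. snd z i \<le> u i)} \<in> sets (borel \<Otimes>\<^sub>M seqs)"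
    if "finite F" for b :: real and F :: "nat set" and u :: "nat \<Rightarrow> ereal"
    unfolding sets_orthants using orthantsI[OF that] by auto
  have product: "emeasure (rate_measure t \<Otimes>\<^sub>M distr M seqs epochs) {z. fst z \<le> b \<and> (\<forall>i\<in>F. snd z i \<le> u i)}
    = emeasure (rate_measure t) {..b} * emeasure M {\<omega> \<in> space M. \<forall>i\<in>F. epochs \<omega> i \<le> u i}"
    if F: "finite F" for b F u
  proof -
    have eq: "{z :: real \<times> (nat \<Rightarrow> ereal). fst z \<le> b \<and> (\<forall>i\<in>F. snd z i \<le> u i)} = {..b} \<times> {x. \<forall>i\<in>F. x i \<le> u i}"
      by auto
    have [measurable]: "{x. \<forall>i\<in>F. x i \<le> u i} \<in> sets seqs"
    proof -
      have "{x \<in> space seqs. \<forall>i\<in>F. x i \<le> u i} \<in> sets seqs" using F by measurable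
      then show ?thesis by (simp add: space_PiM)
    qed
    show ?thesis unfolding eq
      by (subst E.emeasure_pair_measure_Times) (auto simp: emeasure_distr vimage_def Int_def conj_commute intro!: arg_cong2[where f="(*)"])
  qed
  have removal: "emeasure (removal_measure t) {z. fst z \<le> b \<and> (\<forall>i\<in>F. snd z i \<le> u i)}
    = (\<integral>\<^sup>+\<omega>. (\<Sum>j<arrival_count T t \<omega>. of_bool (real_of_ereal (epochs \<omega> j) \<le> b \<and> (\<forall>i\<in>F. (epochs \<omega> \<circ> gap j) i \<le> u i))) \<partial>M)"
    if F: "finite F" for b F u
  proof -
    let ?A = "{z. fst z \<le> b \<and> (\<forall>i\<in>F. snd z i \<le> u i)}"
    have A: "?A \<in> sets (borel \<Otimes>\<^sub>M seqs)" using F by (rule orthant_measurable)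
    have "emeasure (removal_measure t) ?A = (\<integral>\<^sup>+(\<tau>, x). indicator ?A (\<tau>, x) \<partial>removal_measure t)"
      using A by (simp add: case_prod_beta')
    also have "\<dots> = (\<integral>\<^sup>+\<omega>. (\<Sum>j<arrival_count T t \<omega>. indicator ?A (real_of_ereal (epochs \<omega> j), epochs \<omega> \<circ> gap j)) \<partial>M)"
      using A by (intro nn_integral_removal_measure) (simp add: case_prod_beta')
    finally show ?thesis by (simp add: indicator_def of_bool_def)
  qed
  have nonneg: "0 \<le> epochs \<omega> i" if "\<omega> \<in> space M" for \<omega> i
    using epoch_nonneg[of "Suc i"] that by (simp add: epochs_def)
  show eq: "emeasure (removal_measure t) X = emeasure (rate_measure t \<Otimes>\<^sub>M distr M seqs epochs) X" if "X \<in> orthants" for X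
  proof -
    from that obtain b F u where F: "finite F" and X: "X = {z. fst z \<le> b \<and> (\<forall>i\<in>F. snd z i \<le> u i)}" by (rule orthantsE)
    consider "b < 0" | i where "i \<in> F" "u i < 0" | "0 \<le> b" "\<forall>i\<in>F. 0 \<le> u i" by force
    then show ?thesis
    proof cases
      case 1
      have neg: "\<not> real_of_ereal (epochs \<omega> j) \<le> b" if "\<omega> \<in> space M" for \<omega> j
        using 1 real_of_ereal_pos[OF nonneg[OF that, of j]] by simp
      have "emeasure (removal_measure t) X = (\<integral>\<^sup>+\<omega>. 0 \<partial>M)"
        unfolding X removal[OF F] by (intro nn_integral_cong) (simp add: neg)
      moreover have "emeasure (rate_measure t) {..b} = 0"
      proof -
        have "emeasure (rate_measure t) {..b} = (\<integral>\<^sup>+\<tau>. ennreal (indicator {0..t} \<tau> * lam \<tau>) * indicator {..b} \<tau> \<partial>lborel)"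
          unfolding rate_measure_def by (subst emeasure_density) auto
        also have "\<dots> = (\<integral>\<^sup>+\<tau>. 0 \<partial>(lborel :: real measure))"
          using 1 by (intro nn_integral_cong) (auto simp: indicator_def)
        finally show ?thesis by simp
      qed
      ultimately show ?thesis by (simp add: X product[OF F])
    next
      case 2
      then have neg: "\<not> epochs \<omega> k \<le> u i" if "\<omega> \<in> space M" for \<omega> k using nonneg[OF that, of k] by auto
      have "emeasure (removal_measure t) X = (\<integral>\<^sup>+\<omega>. 0 \<partial>M)"
        unfolding X removal[OF F]
        by (intro nn_integral_cong sum.neutral) (use 2 neg in \<open>auto simp: of_bool_def\<close>)
      moreover have empty: "{\<omega> \<in> space M. \<forall>i\<in>F. epochs \<omega> i \<le> u i} = {}" using neg 2 by auto
      ultimately show ?thesis unfolding X product[OF F] empty by simp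
    next
      case 3
      define F' where "F' = {i \<in> F. u i \<noteq> \<infinity>}"
      define v where "v = (\<lambda>i. real_of_ereal (u i))"
      have F': "finite F'" using F by (simp add: F'_def)
      have v: "\<And>i. i \<in> F' \<Longrightarrow> ereal (v i) = u i" "\<And>i. i \<in> F' \<Longrightarrow> 0 \<le> v i"
        using 3(2) by (auto simp: F'_def v_def ereal_real real_of_ereal_pos)
      have iff: "(\<forall>i\<in>F. y i \<le> u i) \<longleftrightarrow> (\<forall>i\<in>F'. y i \<le> ereal (v i))" for y
        using v(1) by (auto simp: F'_def)
      \<comment> \<open>Only arrivals in \<open>[0, t]\<close> count, so \<open>b\<close> can be lowered to \<open>min b t\<close>.\<close>
      have "emeasure (removal_measure t) X
        = (\<integral>\<^sup>+\<omega>. (\<Sum>j<arrival_count T (min b t) \<omega>.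
             of_bool (\<forall>i\<in>F'. i < arrival_count T (v i) \<omega> - of_bool (j < arrival_count T (v i) \<omega>))) \<partial>M)"
        unfolding X removal[OF F]
      proof (rule nn_integral_cong)
        fix \<omega> assume w: "\<omega> \<in> space M"
        have le: "real_of_ereal (epochs \<omega> j) \<le> b \<longleftrightarrow> j < arrival_count T b \<omega>" if "j < arrival_count T t \<omega>" for j
        proof -
          have "epochs \<omega> j \<le> ereal t" using that by (simp add: epochs_le_iff[OF w])
          then have "ereal (real_of_ereal (epochs \<omega> j)) = epochs \<omega> j"
            using nonneg[OF w, of j] by (cases "epochs \<omega> j") auto
          then show ?thesis by (metis ereal_less_eq(3) epochs_le_iff[OF w])
        qed
        have min: "arrival_count T (min b t) \<omega> = min (arrival_count T b \<omega>) (arrival_count T t \<omega>)"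
          by (rule min_of_mono[OF mono_arrival_count[OF w], symmetric])
        show "(\<Sum>j<arrival_count T t \<omega>. of_bool (real_of_ereal (epochs \<omega> j) \<le> b \<and> (\<forall>i\<in>F. (epochs \<omega> \<circ> gap j) i \<le> u i)))
          = (\<Sum>j<arrival_count T (min b t) \<omega>.
             (of_bool (\<forall>i\<in>F'. i < arrival_count T (v i) \<omega> - of_bool (j < arrival_count T (v i) \<omega>)) :: ennreal))"
          unfolding iff remove_epoch_le_iff[OF w] min
          by (intro sum.mono_neutral_cong_right) (auto simp: le)
      qed
      also have "\<dots> = ennreal (LBINT \<tau>:{0..min b t}. lam \<tau>) * emeasure M {\<omega> \<in> space M. \<forall>i\<in>F'. i < arrival_count T (v i) \<omega>}"
        using 3(1) t by (intro removed_counts_expectation F' v(2)) auto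
      also have "ennreal (LBINT \<tau>:{0..min b t}. lam \<tau>) = emeasure (rate_measure t) {..min b t}"
        using 3(1) t by (intro emeasure_rate_measure_atMost[symmetric]) auto
      also have "\<dots> = emeasure (rate_measure t) {..b}"
      proof -
        have "emeasure (rate_measure t) {..c} = (\<integral>\<^sup>+\<tau>. ennreal (indicator {0..t} \<tau> * lam \<tau>) * indicator {..c} \<tau> \<partial>lborel)" for c
          unfolding rate_measure_def by (subst emeasure_density) auto
        then show ?thesis by (auto intro!: nn_integral_cong simp: indicator_def)
      qed
      also have "{\<omega> \<in> space M. \<forall>i\<in>F'. i < arrival_count T (v i) \<omega>} = {\<omega> \<in> space M. \<forall>i\<in>F. epochs \<omega> i \<le> u i}"
        using iff by (auto simp: epochs_le_iff)
      finally show ?thesis by (simp add: X product[OF F])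
    qed
  qed
  fix n
  show "emeasure (removal_measure t) {z. fst z \<le> real n \<and> (\<forall>i\<in>{}. snd z i \<le> 0)} \<noteq> \<infinity>"
  proof -
    have "emeasure (rate_measure t) {..real n} \<le> emeasure (rate_measure t) {..max (real n) t}"
      by (intro emeasure_mono) auto
    also have "\<dots> = (\<integral>\<^sup>+\<tau>. ennreal (indicator {0..t} \<tau> * lam \<tau>) * indicator {..max (real n) t} \<tau> \<partial>lborel)"
      unfolding rate_measure_def by (subst emeasure_density) auto
    also have "\<dots> = (\<integral>\<^sup>+\<tau>. ennreal (indicator {0..t} \<tau> * lam \<tau>) * indicator {..t} \<tau> \<partial>lborel)"
      by (auto intro!: nn_integral_cong simp: indicator_def)
    also have "\<dots> = emeasure (rate_measure t) {..t}"
      unfolding rate_measure_def by (subst emeasure_density) auto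
    also have "\<dots> < \<infinity>" using t by (simp add: emeasure_rate_measure_atMost)
    finally show ?thesis
      unfolding eq[OF orthantsI[OF finite.emptyI]] product[OF finite.emptyI] by (simp add: emeasure_space_1)
  qed
next
  show "sets (rate_measure t \<Otimes>\<^sub>M distr M seqs epochs) = sigma_sets UNIV orthants"
    unfolding sets_orthants[symmetric] by (intro sets_pair_measure_cong) (simp_all add: rate_measure_def)
  show "sets (removal_measure t) = sigma_sets UNIV orthants"
    unfolding sets_orthants[symmetric] by (simp add: removal_measure_def)
  show "range (\<lambda>n. {z. fst z \<le> real n \<and> (\<forall>i\<in>{}. snd z i \<le> 0)}) \<subseteq> orthants"
    by (intro image_subsetI orthantsI finite.emptyI)
  show "(\<Union>n. {z :: real \<times> (nat \<Rightarrow> ereal). fst z \<le> real n \<and> (\<forall>i\<in>{}. snd z i \<le> 0)}) = UNIV"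
    by (auto simp: real_arch_simple)
qed (auto simp: Int_stable_orthants)

text \<open>
  Averaging over the choice of an arrival, the remaining arrivals are distributed like the full
  process, and the chosen epoch has intensity \<open>\<lambda>\<close>.
\<close>
lemma mecke_formula:
  assumes t: "0 \<le> t" and f [measurable]: "f \<in> borel_measurable borel" and H [measurable]: "H \<in> borel_measurable seqs"
  shows "(\<integral>\<^sup>+\<omega>. (\<Sum>j<arrival_count T t \<omega>. f (real_of_ereal (epochs \<omega> j)) * H (epochs \<omega> \<circ> gap j)) \<partial>M)
    = (\<integral>\<^sup>+\<tau>. ennreal (indicator {0..t} \<tau> * lam \<tau>) * f \<tau> \<partial>lborel) * (\<integral>\<^sup>+\<omega>. H (epochs \<omega>) \<partial>M)"
proof -
  interpret E: prob_space "distr M seqs epochs" by (intro prob_space_distr) measurable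
  have rate_sets [simp, measurable_cong]: "sets (rate_measure t) = sets borel"
    by (simp add: rate_measure_def)
  have "(\<integral>\<^sup>+\<omega>. (\<Sum>j<arrival_count T t \<omega>. f (real_of_ereal (epochs \<omega> j)) * H (epochs \<omega> \<circ> gap j)) \<partial>M)
    = (\<integral>\<^sup>+(\<tau>, x). f \<tau> * H x \<partial>removal_measure t)"
    by (intro nn_integral_removal_measure[symmetric]) measurable
  also have "\<dots> = (\<integral>\<^sup>+\<tau>. \<integral>\<^sup>+x. f \<tau> * H x \<partial>distr M seqs epochs \<partial>rate_measure t)"
    unfolding removal_measure_eq[OF t] by (subst E.nn_integral_fst[symmetric]) auto
  also have "\<dots> = (\<integral>\<^sup>+\<tau>. f \<tau> \<partial>rate_measure t) * (\<integral>\<^sup>+\<omega>. H (epochs \<omega>) \<partial>M)"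
    by (simp add: nn_integral_cmult nn_integral_multc nn_integral_distr)
  also have "(\<integral>\<^sup>+\<tau>. f \<tau> \<partial>rate_measure t) = (\<integral>\<^sup>+\<tau>. ennreal (indicator {0..t} \<tau> * lam \<tau>) * f \<tau> \<partial>lborel)"
    unfolding rate_measure_def by (subst nn_integral_density) auto
  finally show ?thesis .
qed

end

section \<open>Sources of randomness\<close>

context infinite_server_network begin

definition source_events :: "source \<Rightarrow> 'a set set" where
  "source_events c = (case c of
     Arrivals \<Rightarrow> sets (arrival_events M T)
   | Batch i \<Rightarrow> sets (batch_events M J (Sig i))
   | Customer j i l \<Rightarrow> sets (path_events M (X j i l)))"

definition sources :: "source set" where
  "sources = {Arrivals} \<union> {Batch i | i. 1 \<le> i}
     \<union> {Customer j i l | j i l. j \<in> {1..J} \<and> 1 \<le> i \<and> 1 \<le> l}"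

definition batch_sources :: "nat \<Rightarrow> source set" where
  "batch_sources i = insert (Batch i) {Customer j i l | j l. j \<in> {1..J} \<and> 1 \<le> l}"

text \<open>
  The \<open>\<sigma>\<close>-algebra generated by a set of sources; it serves only as a measurable space, the measure
  being carried by \<open>M\<close>.
\<close>
definition source_space :: "source set \<Rightarrow> 'a measure" where
  "source_space A = sigma (space M) (\<Union>c\<in>A. source_events c)"

lemma source_events_subset: "source_events c \<subseteq> Pow (space M)"
proof -
  have "space (arrival_events M T) = space M" "space (batch_events M J (Sig i)) = space M"
    "space (path_events M (X j i l)) = space M" for i j l
    by (simp_all add: arrival_events_def batch_events_def path_events_def)
  then show ?thesis
    using sets.space_closed[of "arrival_events M T"] sets.space_closed[of "batch_events M J (Sig i)" for i]
      sets.space_closed[of "path_events M (X j i l)" for j i l]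
    by (cases c) (simp_all add: source_events_def)
qed

lemma space_source_space [simp]: "space (source_space A) = space M"
  unfolding source_space_def by (simp add: space_measure_of_conv)

lemma sets_source_space: "sets (source_space A) = sigma_sets (space M) (\<Union>c\<in>A. source_events c)"
  unfolding source_space_def using source_events_subset by (intro sets_measure_of) blast

text \<open>
  All the independence that is needed below has this form: disjoint groups of sources generate
  independent \<open>\<sigma>\<close>-algebras.
\<close>
lemma indep_source_spaces:
  assumes "\<And>j. j \<in> L \<Longrightarrow> g j \<subseteq> sources" and "disjoint_family_on g L"
  shows "indep_sets (\<lambda>j. sets (source_space (g j))) L"
  unfolding sets_source_space
proof (rule indep_sets_collect_sigma)
  have "(\<Union>j\<in>L. g j) \<subseteq> sources" using assms(1) by blast
  from indep_sets_mono_index[OF this independence[folded source_events_def sources_def]]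
  show "indep_sets source_events (\<Union>j\<in>L. g j)" .
  show "Int_stable (source_events c)" for c
    by (auto simp: source_events_def Int_stable_def split: source.split)
qed fact

lemma sets_source_space_events:
  assumes "A \<subseteq> sources" shows "sets (source_space A) \<subseteq> events"
  using indep_source_spaces[of "{()}" "\<lambda>_. A"] assms
  by (simp add: disjoint_family_on_def indep_sets_def)

lemma measurable_source_space_id:
  assumes "A \<subseteq> sources" shows "(\<lambda>\<omega>. \<omega>) \<in> measurable M (source_space A)"
  using sets_source_space_events[OF assms] sets.sets_into_space by (intro measurableI) (auto simp: Int_absorb1)

lemma measurable_source_spaceD:
  assumes "A \<subseteq> sources" "f \<in> measurable (source_space A) N" shows "f \<in> measurable M N"
  using measurable_compose[OF measurable_source_space_id[OF assms(1)] assms(2)] by simp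

lemma indep_vars_sources:
  assumes g: "\<And>j. j \<in> L \<Longrightarrow> g j \<subseteq> sources" "disjoint_family_on g L"
    and Y: "\<And>j. j \<in> L \<Longrightarrow> Y j \<in> measurable (source_space (g j)) (N j)"
  shows "indep_vars N Y L"
  unfolding indep_vars_def2
proof (intro conjI ballI)
  show "random_variable (N j) (Y j)" if "j \<in> L" for j
    using measurable_source_spaceD[OF g(1) Y] that by blast
  show "indep_sets (\<lambda>i. {Y i -` A \<inter> space M |A. A \<in> sets (N i)}) L"
    by (rule indep_sets_mono_sets[OF indep_source_spaces[OF g]]) (use measurable_sets[OF Y] in auto)
qed

lemma prob_Int_sources:
  assumes "A \<subseteq> sources" "B \<subseteq> sources" "A \<inter> B = {}"
    and "E \<in> sets (source_space A)" "F \<in> sets (source_space B)"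
  shows "prob (E \<inter> F) = prob E * prob F"
proof -
  have "indep_sets (\<lambda>b. sets (source_space (if b then A else B))) (UNIV :: bool set)"
    by (rule indep_source_spaces) (use assms in \<open>auto simp: disjoint_family_on_def split: if_splits\<close>)
  from indep_setsD[OF this, of UNIV "\<lambda>b. if b then E else F"] show ?thesis
    using assms(4,5) by (simp add: UNIV_bool Int_commute mult.commute)
qed

lemma measurable_source:
  assumes c: "c \<in> A" and N: "space N = space M" "sets N \<subseteq> source_events c" and g: "g \<in> measurable K (source_space A)"
  shows "g \<in> measurable K N"
proof -
  have "(\<lambda>\<omega>. \<omega>) \<in> measurable (source_space A) N"
  proof (rule measurableI)
    fix E assume E: "E \<in> sets N"
    then have "E \<subseteq> space M" using sets.sets_into_space N(1) by metis
    moreover have "E \<in> sets (source_space A)"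
      unfolding sets_source_space using E N(2) c by (intro sigma_sets.Basic) auto
    ultimately show "(\<lambda>\<omega>. \<omega>) -` E \<inter> space (source_space A) \<in> sets (source_space A)"
      by (simp add: Int_absorb2)
  qed (simp add: N)
  from measurable_compose[OF g this] show ?thesis by simp
qed

lemma measurable_epochs_source: "epochs \<in> measurable (source_space {Arrivals}) seqs"
proof -
  have "(\<lambda>\<omega>. \<omega>) \<in> measurable (source_space {Arrivals}) (arrival_events M T)"
    by (rule measurable_source[of Arrivals "{Arrivals}"]) (auto simp: source_events_def arrival_events_def)
  moreover have "(\<lambda>\<omega>. \<lambda>i\<in>{1..}. T i \<omega>) \<in> measurable (arrival_events M T) (\<Pi>\<^sub>M i\<in>{1..}. borel)"
    unfolding arrival_events_def by (rule measurable_vimage_algebra1) (auto simp: space_PiM)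
  ultimately have "(\<lambda>\<omega>. \<lambda>i\<in>{1..}. T i \<omega>) \<in> measurable (source_space {Arrivals}) (\<Pi>\<^sub>M i\<in>{1..}. borel)"
    by (rule measurable_compose)
  from measurable_compose[OF this measurable_component_singleton, of "Suc k" for k]
  show ?thesis
    unfolding epochs_def by (intro measurable_PiM_single') auto
qed

lemma measurable_batch_size:
  assumes "Batch i \<in> A" "j \<in> {1..J}" and g: "g \<in> measurable N (source_space A)"
  shows "(\<lambda>x. Sig i j (g x)) \<in> measurable N (count_space UNIV)"
proof -
  have "g \<in> measurable N (batch_events M J (Sig i))"
    by (rule measurable_source[OF assms(1) _ _ g]) (auto simp: source_events_def batch_events_def)
  moreover have "(\<lambda>\<omega>. \<lambda>j\<in>{1..J}. Sig i j \<omega>) \<in> measurable (batch_events M J (Sig i)) (\<Pi>\<^sub>M j\<in>{1..J}. count_space UNIV)"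
    unfolding batch_events_def by (rule measurable_vimage_algebra1) (auto simp: space_PiM)
  ultimately have "(\<lambda>x. \<lambda>j\<in>{1..J}. Sig i j (g x)) \<in> measurable N (\<Pi>\<^sub>M j\<in>{1..J}. count_space UNIV)"
    by (rule measurable_compose)
  from measurable_compose[OF this measurable_component_singleton, of j] show ?thesis
    using assms(2) by simp
qed

lemma measurable_position:
  assumes "Customer j i l \<in> A" "j \<in> {1..J}" "1 \<le> i" "1 \<le> l" and g: "g \<in> measurable N (source_space A)"
    and s: "s \<in> borel_measurable N" "\<And>x. x \<in> space N \<Longrightarrow> 0 \<le> s x"
  shows "(\<lambda>x. X j i l (s x) (g x)) \<in> measurable N (count_space UNIV)"
proof -
  have "g \<in> measurable N (path_events M (X j i l))"
    by (rule measurable_source[OF assms(1) _ _ g]) (auto simp: source_events_def path_events_def)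
  moreover have "s \<in> measurable N (restrict_space borel {0..})"
    using s by (intro measurable_restrict_space2) auto
  ultimately have "(\<lambda>x. (s x, g x)) \<in> measurable N (restrict_space borel {0..} \<Otimes>\<^sub>M path_events M (X j i l))"
    by simp
  from measurable_compose[OF this path_jointly_measurable] show ?thesis using assms by simp
qed

text \<open>
  The age \<open>s\<close> may depend on the point of \<open>N\<close>, which is why joint measurability of the paths in time
  and sample point enters.  The random number of summands is handled by treating each of its
  countably many values separately.
\<close>
lemma measurable_batch_queue_count:
  assumes A: "batch_sources i \<subseteq> A" and i: "1 \<le> i" and g: "g \<in> measurable N (source_space A)"
    and s: "s \<in> borel_measurable N" "\<And>x. x \<in> space N \<Longrightarrow> 0 \<le> s x"
  shows "(\<lambda>x. batch_queue_count J Sig X i k (s x) (g x)) \<in> measurable N (count_space UNIV)"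
  unfolding batch_queue_count_def
proof (rule measurable_count_space_sum)
  fix j assume j: "j \<in> {1..J}"
  have X [measurable]: "(\<lambda>x. X j i l (s x) (g x)) \<in> measurable N (count_space UNIV)" if "1 \<le> l" for l
    using A that j i g s by (intro measurable_position[where A=A]) (auto simp: batch_sources_def)
  have [measurable]: "(\<lambda>x. of_bool (X j i l (s x) (g x) = k) :: nat) \<in> measurable N (count_space UNIV)" if "1 \<le> l" for l
    using measurable_compose[OF X[OF that], of "\<lambda>y. of_bool (y = k)" "count_space UNIV"] by simp
  have "(\<lambda>x. Sig i j (g x)) \<in> measurable N (count_space UNIV)"
    using A j g by (intro measurable_batch_size[where A=A]) (auto simp: batch_sources_def)
  then show "(\<lambda>x. \<Sum>l=1..Sig i j (g x). of_bool (X j i l (s x) (g x) = k)) \<in> measurable N (count_space (UNIV :: nat set))"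
    by (rule measurable_compose_countable[rotated]) (intro measurable_count_space_sum, auto)
qed

section \<open>The law of a batch\<close>

abbreviation vecs :: "(nat \<Rightarrow> nat) measure" where
  "vecs \<equiv> \<Pi>\<^sub>M k\<in>{1..J}. count_space UNIV"

text \<open>
  The vector is determined by the position once all values outside \<open>{1..J}\<close> are identified, here with \<open>0\<close>;
  the law of the clipped position is given by the occupancy probabilities, the value \<open>0\<close> receiving
  the remaining mass.
\<close>
lemma distr_position_vector:
  assumes i: "1 \<le> i" "1 \<le> i'" and j: "j \<in> {1..J}" and l: "1 \<le> l" and s: "0 \<le> s"
  shows "distr M vecs (\<lambda>\<omega>. \<lambda>k\<in>{1..J}. of_bool (X j i l s \<omega> = k))
       = distr M vecs (\<lambda>\<omega>. \<lambda>k\<in>{1..J}. of_bool (X j i' l s \<omega> = k))"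
proof -
  define clip where "clip = (\<lambda>k::nat. if k \<in> {1..J} then k else 0)"
  have X [measurable]: "X j i l s \<in> measurable M (count_space UNIV)" if "1 \<le> i" for i
    using path_measurable[OF that j l s] .
  have law: "distr M (count_space UNIV) (\<lambda>\<omega>. clip (X j i l s \<omega>)) = density (count_space UNIV)
      (\<lambda>k. ennreal (if k = 0 then 1 - (\<Sum>k=1..J. q j k s) else if k \<le> J then q j k s else 0))" (is "_ = density _ ?p")
    if i: "1 \<le> i" for i
  proof (rule measure_eqI_countable[of _ UNIV])
    fix k :: nat
    have q: "prob {\<omega> \<in> space M. X j i l s \<omega> = k} = q j k s" if "k \<in> {1..J}" for k
      using occupancy[OF i j l that s] .
    have "prob {\<omega> \<in> space M. X j i l s \<omega> \<in> {1..J}} = (\<Sum>k=1..J. q j k s)"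
    proof -
      have "{\<omega> \<in> space M. X j i l s \<omega> \<in> {1..J}} = (\<Union>k\<in>{1..J}. {\<omega> \<in> space M. X j i l s \<omega> = k})" by auto
      then have "prob {\<omega> \<in> space M. X j i l s \<omega> \<in> {1..J}} = (\<Sum>k=1..J. prob {\<omega> \<in> space M. X j i l s \<omega> = k})"
        using X[OF i] by (simp only:) (intro finite_measure_finite_Union, auto simp: disjoint_family_on_def)
      then show ?thesis by (simp add: q)
    qed
    moreover have "prob {\<omega> \<in> space M. X j i l s \<omega> \<notin> {1..J}} = 1 - prob {\<omega> \<in> space M. X j i l s \<omega> \<in> {1..J}}"
      using X[OF i] by (intro prob_neg) auto
    moreover have "prob {\<omega> \<in> space M. clip (X j i l s \<omega>) = k} =
      (if k = 0 then prob {\<omega> \<in> space M. X j i l s \<omega> \<notin> {1..J}} else if k \<le> J then prob {\<omega> \<in> space M. X j i l s \<omega> = k} else prob {})"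
    proof -
      have "{\<omega> \<in> space M. clip (X j i l s \<omega>) = k} = (if k = 0 then {\<omega> \<in> space M. X j i l s \<omega> \<notin> {1..J}}
        else if k \<le> J then {\<omega> \<in> space M. X j i l s \<omega> = k} else {})"
        by (auto simp: clip_def)
      then show ?thesis by simp
    qed
    ultimately have "prob {\<omega> \<in> space M. clip (X j i l s \<omega>) = k}
      = (if k = 0 then 1 - (\<Sum>k=1..J. q j k s) else if k \<le> J then q j k s else 0)"
      using q[of k] by simp
    moreover have "emeasure (distr M (count_space UNIV) (\<lambda>\<omega>. clip (X j i l s \<omega>))) {k} = prob {\<omega> \<in> space M. clip (X j i l s \<omega>) = k}"
      using X[OF i] by (subst emeasure_distr) (auto simp: emeasure_eq_measure vimage_def Int_def conj_commute)
    moreover have "emeasure (density (count_space UNIV) ?p) {k} = ?p k"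
      by (subst emeasure_density) (auto simp: nn_integral_count_space_indicator[symmetric])
    ultimately show "emeasure (distr M (count_space UNIV) (\<lambda>\<omega>. clip (X j i l s \<omega>))) {k} = emeasure (density (count_space UNIV) ?p) {k}"
      by simp
  qed auto
  define e where "e = (\<lambda>y. \<lambda>k\<in>{1..J}. of_bool (y = k) :: nat)"
  have e: "e \<in> measurable (count_space UNIV) vecs" by (auto simp: e_def space_PiM)
  have "distr M vecs (\<lambda>\<omega>. \<lambda>k\<in>{1..J}. of_bool (X j i l s \<omega> = k)) = distr (distr M (count_space UNIV) (\<lambda>\<omega>. clip (X j i l s \<omega>))) vecs e"
    if "1 \<le> i" for i
    using X[OF that] e by (subst distr_distr) (auto simp: e_def clip_def fun_eq_iff intro!: distr_cong)
  then show ?thesis using law i by simp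
qed

text \<open>
  The batch sizes (index \<open>None\<close>) and the positions of the customers \<open>l\<close> of queue \<open>j\<close> (index \<open>Some (j, l)\<close>)
  are independent with laws that do not depend on the batch, hence so is their joint law, and the
  counts are the image of that family under one fixed map.  Sizes and positions are both
  represented by vectors indexed by the queues in order to form one family.
\<close>
lemma distr_batch_count_vector:
  assumes i: "1 \<le> i" "1 \<le> i'" and s: "0 \<le> s"
  shows "distr M vecs (\<lambda>\<omega>. \<lambda>k\<in>{1..J}. batch_queue_count J Sig X i k s \<omega>)
       = distr M vecs (\<lambda>\<omega>. \<lambda>k\<in>{1..J}. batch_queue_count J Sig X i' k s \<omega>)"
proof -
  define I where "I = insert None (Some ` ({1..J} \<times> {1::nat..}))"
  define Z where "Z = (\<lambda>i c \<omega>. case c of None \<Rightarrow> (\<lambda>j\<in>{1..J}. Sig i j \<omega>)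
     | Some (j, l) \<Rightarrow> (\<lambda>k\<in>{1..J}. of_bool (X j i l s \<omega> = k)))"
  define g where "g = (\<lambda>i c. case c of None \<Rightarrow> {Batch i} | Some (j, l) \<Rightarrow> {Customer j i l})"
  define \<Phi> where "\<Phi> = (\<lambda>y. \<lambda>k\<in>{1..J}. \<Sum>j=1..J. \<Sum>l=1..y None j. y (Some (j, l)) k :: nat)"
  have Z: "Z i c \<in> measurable (source_space (g i c)) vecs" if "1 \<le> i" "c \<in> I" for i c
  proof (cases c)
    case None
    then show ?thesis unfolding Z_def g_def
      by (auto intro!: measurable_restrict measurable_batch_size[where A="{Batch i}"])
  next
    case (Some p)
    then obtain j l where c: "c = Some (j, l)" "j \<in> {1..J}" "1 \<le> l" using \<open>c \<in> I\<close> by (auto simp: I_def)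
    have "X j i l s \<in> measurable (source_space {Customer j i l}) (count_space UNIV)"
      using c that s by (intro measurable_position[where A="{Customer j i l}" and g="\<lambda>\<omega>. \<omega>"]) auto
    from measurable_compose[OF this, of "\<lambda>y. of_bool (y = k)" "count_space UNIV" for k]
    show ?thesis unfolding Z_def g_def c by (auto intro!: measurable_restrict)
  qed
  have indep: "indep_vars (\<lambda>_. vecs) (Z i) I" if "1 \<le> i" for i
    by (rule indep_vars_sources[where g="g i"])
      (use that Z in \<open>auto simp: g_def sources_def I_def disjoint_family_on_def split: option.splits\<close>)
  have \<Phi>: "\<Phi> \<in> measurable (\<Pi>\<^sub>M c\<in>I. vecs) vecs"
    unfolding \<Phi>_def
  proof (intro measurable_restrict measurable_count_space_sum)
    fix k j assume k: "k \<in> {1..J}" and j: "j \<in> {1..J}"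
    have I: "None \<in> I" "\<And>j l. j \<in> {1..J} \<Longrightarrow> 1 \<le> l \<Longrightarrow> Some (j, l) \<in> I" by (auto simp: I_def)
    have "(\<lambda>y. \<Sum>l=1..b. y (Some (j, l)) k) \<in> measurable (\<Pi>\<^sub>M c\<in>I. vecs) (count_space (UNIV :: nat set))" for b
      by (intro measurable_count_space_sum measurable_component2 I j k) simp
    then show "(\<lambda>y. \<Sum>l=1..y None j. y (Some (j, l)) k) \<in> measurable (\<Pi>\<^sub>M c\<in>I. vecs) (count_space (UNIV :: nat set))"
      by (rule measurable_compose_countable) (intro measurable_component2 I j)
  qed
  have eq: "distr M vecs (\<lambda>\<omega>. \<lambda>k\<in>{1..J}. batch_queue_count J Sig X i k s \<omega>)
     = distr (\<Pi>\<^sub>M c\<in>I. distr M vecs (Z i c)) vecs \<Phi>" if "1 \<le> i" for i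
  proof -
    have rv: "random_variable vecs (Z i c)" if "c \<in> I" for c
      using indep[OF \<open>1 \<le> i\<close>] that by (auto simp: indep_vars_def)
    have "distr M vecs (\<lambda>\<omega>. \<lambda>k\<in>{1..J}. batch_queue_count J Sig X i k s \<omega>)
      = distr (distr M (\<Pi>\<^sub>M c\<in>I. vecs) (\<lambda>\<omega>. \<lambda>c\<in>I. Z i c \<omega>)) vecs \<Phi>"
      using \<Phi> rv
      by (subst distr_distr)
        (auto intro!: distr_cong sum.cong simp: \<Phi>_def Z_def I_def batch_queue_count_def fun_eq_iff)
    also have "distr M (\<Pi>\<^sub>M c\<in>I. vecs) (\<lambda>\<omega>. \<lambda>c\<in>I. Z i c \<omega>) = (\<Pi>\<^sub>M c\<in>I. distr M vecs (Z i c))"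
      using indep[OF that] rv by (subst (asm) indep_vars_iff_distr_eq_PiM') (auto simp: I_def)
    finally show ?thesis .
  qed
  have "distr M vecs (Z i c) = distr M vecs (Z i' c)" if "c \<in> I" for c
    using that i batch_distr[OF i(1)] batch_distr[OF i(2)] distr_position_vector[OF i _ _ s]
    by (auto simp: I_def Z_def)
  then have "(\<Pi>\<^sub>M c\<in>I. distr M vecs (Z i c)) = (\<Pi>\<^sub>M c\<in>I. distr M vecs (Z i' c))"
    by (intro PiM_cong) auto
  then show ?thesis using eq i by simp
qed

lemma prob_vector_eq:
  assumes Y: "\<And>k. k \<in> {1..J} \<Longrightarrow> Y k \<in> measurable M (count_space UNIV)"
  shows "prob {\<omega> \<in> space M. \<forall>k\<in>{1..J}. Y k \<omega> = n k} = measure (distr M vecs (\<lambda>\<omega>. \<lambda>k\<in>{1..J}. Y k \<omega>)) {y \<in> space vecs. \<forall>k\<in>{1..J}. y k = n k}"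
proof (subst measure_distr)
  show "(\<lambda>\<omega>. \<lambda>k\<in>{1..J}. Y k \<omega>) \<in> measurable M vecs" using Y by (rule measurable_restrict)
  show "{y \<in> space vecs. \<forall>k\<in>{1..J}. y k = n k} \<in> sets vecs" by measurable
  show "prob {\<omega> \<in> space M. \<forall>k\<in>{1..J}. Y k \<omega> = n k}
    = prob ((\<lambda>\<omega>. \<lambda>k\<in>{1..J}. Y k \<omega>) -` {y \<in> space vecs. \<forall>k\<in>{1..J}. y k = n k} \<inter> space M)"
    by (rule arg_cong[where f=prob]) (auto simp: space_PiM)
qed

lemma batch_sources_subset: "1 \<le> i \<Longrightarrow> batch_sources i \<subseteq> sources - {Arrivals}"
  by (auto simp: batch_sources_def sources_def)

lemma batch_sources_disjoint: "i \<noteq> i' \<Longrightarrow> batch_sources i \<inter> batch_sources i' = {}"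
  by (auto simp: batch_sources_def)

lemma measurable_batch_queue_count_fixed:
  "1 \<le> i \<Longrightarrow> 0 \<le> s \<Longrightarrow> batch_queue_count J Sig X i k s \<in> measurable (source_space (batch_sources i)) (count_space UNIV)"
  by (rule measurable_batch_queue_count[OF order_refl, where g="\<lambda>\<omega>. \<omega>" and s="\<lambda>_. s"]) auto

lemma measurable_batch_queue_count_M:
  assumes "1 \<le> i" "0 \<le> s" shows "batch_queue_count J Sig X i k s \<in> measurable M (count_space UNIV)"
  using batch_sources_subset[OF assms(1)] measurable_batch_queue_count_fixed[OF assms]
  by (intro measurable_source_spaceD[of "batch_sources i"]) auto

text \<open>
  Different batches are independent and have the same law at the same age, so the joint law does
  not depend on which distinct batches occupy the \<open>m\<close> places.
\<close>
lemma prob_sum_batch_counts: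
  fixes m :: nat
  assumes \<pi>: "inj_on \<pi> {..<m}" "\<And>i. i < m \<Longrightarrow> 1 \<le> \<pi> i" and \<pi>': "inj_on \<pi>' {..<m}" "\<And>i. i < m \<Longrightarrow> 1 \<le> \<pi>' i"
    and s: "\<And>i. i < m \<Longrightarrow> 0 \<le> s i"
  shows "prob {\<omega> \<in> space M. \<forall>k\<in>{1..J}. (\<Sum>i<m. batch_queue_count J Sig X (\<pi> i) k (s i) \<omega>) = n k}
    = prob {\<omega> \<in> space M. \<forall>k\<in>{1..J}. (\<Sum>i<m. batch_queue_count J Sig X (\<pi>' i) k (s i) \<omega>) = n k}"
proof (cases "m = 0")
  case False
  define Z where "Z = (\<lambda>\<pi> i \<omega>. \<lambda>k\<in>{1..J}. batch_queue_count J Sig X (\<pi> i) k (s i) \<omega>)"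
  define \<Phi> where "\<Phi> = (\<lambda>y. \<lambda>k\<in>{1..J}. \<Sum>i<m. y i k :: nat)"
  have \<Phi>: "\<Phi> \<in> measurable (\<Pi>\<^sub>M i\<in>{..<m}. vecs) vecs"
    unfolding \<Phi>_def
    by (intro measurable_restrict measurable_count_space_sum measurable_component2)
  have eq: "distr M vecs (\<lambda>\<omega>. \<lambda>k\<in>{1..J}. \<Sum>i<m. batch_queue_count J Sig X (\<pi> i) k (s i) \<omega>)
    = distr (\<Pi>\<^sub>M i\<in>{..<m}. distr M vecs (Z \<pi> i)) vecs \<Phi>"
    if \<pi>: "inj_on \<pi> {..<m}" "\<forall>i<m. 1 \<le> \<pi> i" for \<pi>
  proof -
    have indep: "indep_vars (\<lambda>_. vecs) (Z \<pi>) {..<m}"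
    proof (rule indep_vars_sources[where g="\<lambda>i. batch_sources (\<pi> i)"])
      show "disjoint_family_on (\<lambda>i. batch_sources (\<pi> i)) {..<m}"
        unfolding disjoint_family_on_def using inj_onD[OF \<pi>(1)]
        by (intro ballI impI batch_sources_disjoint) blast
      show "Z \<pi> i \<in> measurable (source_space (batch_sources (\<pi> i))) vecs" if "i \<in> {..<m}" for i
        unfolding Z_def using \<pi>(2) s that
        by (intro measurable_restrict measurable_batch_queue_count_fixed) auto
    qed (use \<pi>(2) batch_sources_subset in blast)
    then have rv: "random_variable vecs (Z \<pi> i)" if "i < m" for i
      using that by (auto simp: indep_vars_def)
    have "distr M vecs (\<lambda>\<omega>. \<lambda>k\<in>{1..J}. \<Sum>i<m. batch_queue_count J Sig X (\<pi> i) k (s i) \<omega>)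
      = distr (distr M (\<Pi>\<^sub>M i\<in>{..<m}. vecs) (\<lambda>\<omega>. \<lambda>i\<in>{..<m}. Z \<pi> i \<omega>)) vecs \<Phi>"
      using \<Phi> rv by (subst distr_distr) (auto intro!: distr_cong simp: \<Phi>_def Z_def fun_eq_iff)
    also have "distr M (\<Pi>\<^sub>M i\<in>{..<m}. vecs) (\<lambda>\<omega>. \<lambda>i\<in>{..<m}. Z \<pi> i \<omega>) = (\<Pi>\<^sub>M i\<in>{..<m}. distr M vecs (Z \<pi> i))"
      using indep rv False by (subst (asm) indep_vars_iff_distr_eq_PiM') auto
    finally show ?thesis .
  qed
  have "(\<Pi>\<^sub>M i\<in>{..<m}. distr M vecs (Z \<pi> i)) = (\<Pi>\<^sub>M i\<in>{..<m}. distr M vecs (Z \<pi>' i))"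
    unfolding Z_def using \<pi>(2) \<pi>'(2) s by (intro PiM_cong distr_batch_count_vector) auto
  then have "distr (\<Pi>\<^sub>M i\<in>{..<m}. distr M vecs (Z \<pi> i)) vecs \<Phi> = distr (\<Pi>\<^sub>M i\<in>{..<m}. distr M vecs (Z \<pi>' i)) vecs \<Phi>"
    by (rule arg_cong)
  then have "distr M vecs (\<lambda>\<omega>. \<lambda>k\<in>{1..J}. \<Sum>i<m. batch_queue_count J Sig X (\<pi> i) k (s i) \<omega>)
    = distr M vecs (\<lambda>\<omega>. \<lambda>k\<in>{1..J}. \<Sum>i<m. batch_queue_count J Sig X (\<pi>' i) k (s i) \<omega>)"
    using eq[OF \<pi>(1)] eq[OF \<pi>'(1)] \<pi>(2) \<pi>'(2) by simp
  moreover have "(\<lambda>\<omega>. \<Sum>i<m. batch_queue_count J Sig X (\<pi> i) k (s i) \<omega>) \<in> measurable M (count_space UNIV)"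
    if "\<And>i. i < m \<Longrightarrow> 1 \<le> \<pi> i" for k \<pi>
    using that s by (intro measurable_count_space_sum measurable_batch_queue_count_M) auto
  ultimately show ?thesis using \<pi>(2) \<pi>'(2) by (subst (1 2) prob_vector_eq) auto
qed simp

section \<open>The population given the epochs\<close>

abbreviation marks :: "'a measure" where
  "marks \<equiv> source_space (sources - {Arrivals})"

text \<open>
  The population at time \<open>t\<close> when the epochs are the deterministic sequence \<open>x\<close>.  For an increasing \<open>x\<close>
  the minimum is the number of arrivals up to \<open>t\<close>.  Like the truncation of the ages at \<open>0\<close>, it is chosen so that
  the expression is jointly measurable on the space of all sequences, increasing or not.
\<close>
definition population :: "real \<Rightarrow> (nat \<Rightarrow> ereal) \<Rightarrow> nat \<Rightarrow> 'a \<Rightarrow> nat" where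
  "population t x k \<omega> = (\<Sum>i<(LEAST m. ereal t < x m).
     batch_queue_count J Sig X (Suc i) k (max 0 (t - real_of_ereal (x i))) \<omega>)"

lemma measurable_population:
  assumes x [measurable]: "x \<in> measurable N seqs" and g: "g \<in> measurable N marks"
  shows "(\<lambda>y. population t (x y) k (g y)) \<in> measurable N (count_space UNIV)"
  unfolding population_def
proof (rule measurable_compose_countable[where f="\<lambda>m y. \<Sum>i<m. batch_queue_count J Sig X (Suc i) k (max 0 (t - real_of_ereal (x y i))) (g y)"])
  have [measurable]: "(\<lambda>y. x y i) \<in> borel_measurable N" for i
    using measurable_compose[OF x measurable_component_singleton, of i] by simp
  show "(\<lambda>y. LEAST m. ereal t < x y m) \<in> measurable N (count_space UNIV)" by measurable
  show "(\<lambda>y. \<Sum>i<m. batch_queue_count J Sig X (Suc i) k (max 0 (t - real_of_ereal (x y i))) (g y)) \<in> measurable N (count_space UNIV)" for m :: nat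
    by (intro measurable_count_space_sum measurable_batch_queue_count[OF batch_sources_subset _ g]) auto
qed

lemma Least_greater_epochs:
  assumes "\<omega> \<in> space M" shows "(LEAST m. ereal t < epochs \<omega> m) = arrival_count T t \<omega>"
proof (rule Least_equality)
  show "ereal t < epochs \<omega> (arrival_count T t \<omega>)"
    using epochs_le_iff[OF assms, of "arrival_count T t \<omega>" t] by simp
  show "arrival_count T t \<omega> \<le> m" if "ereal t < epochs \<omega> m" for m
    using epochs_le_iff[OF assms, of m t] that by (meson not_le)
qed

lemma Least_greater_removed_epochs:
  assumes "\<omega> \<in> space M" "j < arrival_count T t \<omega>"
  shows "(LEAST m. ereal t < (epochs \<omega> \<circ> gap j) m) = arrival_count T t \<omega> - 1"
proof (rule Least_equality)
  have *: "ereal t < (epochs \<omega> \<circ> gap j) m \<longleftrightarrow> arrival_count T t \<omega> - 1 \<le> m" for m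
    using remove_epoch_le_iff[OF assms(1), of j m t] assms(2) by (simp del: comp_apply add: not_less not_le[symmetric])
  show "ereal t < (epochs \<omega> \<circ> gap j) (arrival_count T t \<omega> - 1)" by (simp only: *) 
  show "arrival_count T t \<omega> - 1 \<le> m" if "ereal t < (epochs \<omega> \<circ> gap j) m" for m
    using that by (simp only: *)
qed

lemma epochs_age:
  assumes "\<omega> \<in> space M" "i < arrival_count T t \<omega>"
  shows "0 \<le> t - real_of_ereal (epochs \<omega> i)"
proof -
  have "epochs \<omega> i \<le> ereal t" using epochs_le_iff[OF assms(1)] assms(2) by simp
  moreover have "0 \<le> epochs \<omega> i" using epoch_nonneg[of "Suc i"] assms(1) by (simp add: epochs_def)
  ultimately show ?thesis by (cases "epochs \<omega> i") auto
qed

lemma queue_count_eq_population: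
  assumes w: "\<omega> \<in> space M"
  shows "queue_count J T Sig X k t \<omega> = population t (epochs \<omega>) k \<omega>"
proof -
  let ?B = "SIGMA i:{..<arrival_count T t \<omega>}. SIGMA j:{1..J}.
    {l \<in> {1..Sig (Suc i) j \<omega>}. X j (Suc i) l (t - real_of_ereal (epochs \<omega> i)) \<omega> = k}"
  have "bij_betw (\<lambda>(i, j, l). (Suc i, j, l)) ?B {(i, j, l). 1 \<le> i \<and> T i \<omega> \<le> ereal t \<and> j \<in> {1..J} \<and> l \<in> {1..Sig i j \<omega>} \<and>
             X j i l (t - real_of_ereal (T i \<omega>)) \<omega> = k}"
  proof (rule bij_betwI[where g="\<lambda>(i, j, l). (i - 1, j, l)"])
    have le: "T (Suc i) \<omega> \<le> ereal t \<longleftrightarrow> i < arrival_count T t \<omega>" for i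
      using epochs_le_iff[OF w, of i t] by (simp add: epochs_def)
    show "(\<lambda>(i, j, l). (Suc i, j, l)) \<in> ?B \<rightarrow> {(i, j, l). 1 \<le> i \<and> T i \<omega> \<le> ereal t \<and> j \<in> {1..J} \<and> l \<in> {1..Sig i j \<omega>} \<and>
             X j i l (t - real_of_ereal (T i \<omega>)) \<omega> = k}"
      by (auto simp: epochs_def le)
    show "(\<lambda>(i, j, l). (i - 1, j, l)) \<in> {(i, j, l). 1 \<le> i \<and> T i \<omega> \<le> ereal t \<and> j \<in> {1..J} \<and> l \<in> {1..Sig i j \<omega>} \<and>
             X j i l (t - real_of_ereal (T i \<omega>)) \<omega> = k} \<rightarrow> ?B"
      by (auto simp: epochs_def le gr0_conv_Suc Suc_le_eq)
  qed auto
  then have "queue_count J T Sig X k t \<omega> = card ?B"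
    unfolding queue_count_def by (rule bij_betw_same_card[symmetric])
  also have "\<dots> = (\<Sum>i<arrival_count T t \<omega>. \<Sum>j=1..J. card {l \<in> {1..Sig (Suc i) j \<omega>}. X j (Suc i) l (t - real_of_ereal (epochs \<omega> i)) \<omega> = k})"
    by (simp add: card_SigmaI)
  also have "\<dots> = population t (epochs \<omega>) k \<omega>"
    unfolding population_def Least_greater_epochs[OF w] batch_queue_count_def
  proof (intro sum.cong refl)
    fix i j assume "i \<in> {..<arrival_count T t \<omega>}"
    then have "max 0 (t - real_of_ereal (epochs \<omega> i)) = t - real_of_ereal (epochs \<omega> i)"
      using epochs_age[OF w] by (simp add: max_def)
    then show "card {l \<in> {1..Sig (Suc i) j \<omega>}. X j (Suc i) l (t - real_of_ereal (epochs \<omega> i)) \<omega> = k}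
      = (\<Sum>l=1..Sig (Suc i) j \<omega>. of_bool (X j (Suc i) l (max 0 (t - real_of_ereal (epochs \<omega> i))) \<omega> = k))"
      by (simp add: of_bool_def sum.If_cases Int_def)
  qed
  finally show ?thesis .
qed

text \<open>
  As a function of \<open>x\<close>, the conditional law of the population given the epochs.
\<close>
definition population_law :: "real \<Rightarrow> (nat \<Rightarrow> nat) \<Rightarrow> (nat \<Rightarrow> ereal) \<Rightarrow> ennreal" where
  "population_law t n x = emeasure M {\<omega> \<in> space M. \<forall>k\<in>{1..J}. population t x k \<omega> = n k}"

lemma marks_sources: "sources - {Arrivals} \<subseteq> sources" by auto

lemma emeasure_marks:
  "E \<in> sets marks \<Longrightarrow> emeasure (distr M marks (\<lambda>\<omega>. \<omega>)) E = emeasure M E"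
  using sets.sets_into_space[of E marks]
  by (subst emeasure_distr[OF measurable_source_space_id[OF marks_sources]]) (auto simp: Int_absorb2)

text \<open>
  Batches and customers are evaluated on a second copy of the sample space, equipped with their own
  \<open>\<sigma>\<close>-algebra; probabilities of sections then depend measurably on the parameter.
\<close>
lemma borel_measurable_marks_section:
  assumes E: "{y \<in> space (N \<Otimes>\<^sub>M marks). P (fst y) (snd y)} \<in> sets (N \<Otimes>\<^sub>M marks)"
  shows "(\<lambda>x. emeasure M {\<omega> \<in> space M. P x \<omega>}) \<in> borel_measurable N"
    and "\<And>x. x \<in> space N \<Longrightarrow> {\<omega> \<in> space M. P x \<omega>} \<in> sets marks"
proof -
  let ?E = "{y \<in> space (N \<Otimes>\<^sub>M marks). P (fst y) (snd y)}"
  interpret D: prob_space "distr M marks (\<lambda>\<omega>. \<omega>)"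
    by (rule prob_space_distr[OF measurable_source_space_id[OF marks_sources]])
  have eq: "Pair x -` ?E = {\<omega> \<in> space M. P x \<omega>}" if "x \<in> space N" for x
    using that by (auto simp: space_pair_measure)
  have "?E \<in> sets (N \<Otimes>\<^sub>M distr M marks (\<lambda>\<omega>. \<omega>))"
    using E by (simp cong: sets_pair_measure_cong)
  from D.measurable_emeasure_Pair[OF this]
  have m: "(\<lambda>x. emeasure (distr M marks (\<lambda>\<omega>. \<omega>)) (Pair x -` ?E)) \<in> borel_measurable N" .
  show s: "{\<omega> \<in> space M. P x \<omega>} \<in> sets marks" if "x \<in> space N" for x
    using sets_Pair1[OF E, of x] eq[OF that] by simp
  have "(\<lambda>x. emeasure M {\<omega> \<in> space M. P x \<omega>}) \<in> borel_measurable N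
    \<longleftrightarrow> (\<lambda>x. emeasure (distr M marks (\<lambda>\<omega>. \<omega>)) (Pair x -` ?E)) \<in> borel_measurable N"
    by (rule measurable_cong) (simp only: eq emeasure_marks[OF s])
  then show "(\<lambda>x. emeasure M {\<omega> \<in> space M. P x \<omega>}) \<in> borel_measurable N" using m by simp
qed

lemma sets_population_event:
  "{y \<in> space (seqs \<Otimes>\<^sub>M marks). \<forall>k\<in>{1..J}. population t (fst y) k (snd y) = n k} \<in> sets (seqs \<Otimes>\<^sub>M marks)"
proof -
  have [measurable]: "(\<lambda>y. population t (fst y) k (snd y)) \<in> measurable (seqs \<Otimes>\<^sub>M marks) (count_space UNIV)" for k
    by (rule measurable_population) auto
  show ?thesis by measurable
qed

lemma borel_measurable_population_law [measurable]: "population_law t n \<in> borel_measurable seqs"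
  unfolding population_law_def
  by (rule borel_measurable_marks_section(1)[where P="\<lambda>x \<omega>. \<forall>k\<in>{1..J}. population t x k \<omega> = n k", OF sets_population_event])

text \<open>
  The epochs are independent of the \<open>\<sigma>\<close>-algebra of the marks, so \<open>\<omega> \<mapsto> (epochs \<omega>, \<omega>)\<close> maps \<open>M\<close> to a
  product measure, and Fubini's theorem applies.
\<close>
lemma emeasure_queue_count:
  "emeasure M {\<omega> \<in> space M. \<forall>k\<in>{1..J}. queue_count J T Sig X k t \<omega> = n k} = (\<integral>\<^sup>+\<omega>. population_law t n (epochs \<omega>) \<partial>M)"
proof -
  let ?D = "distr M marks (\<lambda>\<omega>. \<omega>)"
  let ?E = "{y \<in> space (seqs \<Otimes>\<^sub>M marks). \<forall>k\<in>{1..J}. population t (fst y) k (snd y) = n k}"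
  interpret D: prob_space ?D
    by (rule prob_space_distr[OF measurable_source_space_id[OF marks_sources]])
  note id = measurable_source_space_id[OF marks_sources]
  have arr: "{Arrivals} \<subseteq> sources" by (auto simp: sources_def)
  have "distr M (seqs \<Otimes>\<^sub>M marks) (\<lambda>\<omega>. (epochs \<omega>, \<omega>)) = distr M seqs epochs \<Otimes>\<^sub>M ?D"
  proof (rule distr_pair_indep[OF measurable_epochs id])
    fix a b assume a: "a \<in> sets seqs" and b: "b \<in> sets marks"
    have "epochs -` a \<inter> space M \<in> sets (source_space {Arrivals})"
      using measurable_sets[OF measurable_epochs_source a] by simp
    from prob_Int_sources[OF arr marks_sources _ this b]
    have "prob (epochs -` a \<inter> space M \<inter> b) = prob (epochs -` a \<inter> space M) * prob b" by simp
    moreover have "{\<omega> \<in> space M. epochs \<omega> \<in> a \<and> \<omega> \<in> b} = epochs -` a \<inter> space M \<inter> b"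
      "{\<omega> \<in> space M. epochs \<omega> \<in> a} = epochs -` a \<inter> space M" by auto
    moreover have "{\<omega> \<in> space M. \<omega> \<in> b} = b" using sets.sets_into_space[OF b] by auto
    ultimately show "prob {\<omega> \<in> space M. epochs \<omega> \<in> a \<and> \<omega> \<in> b} = prob {\<omega> \<in> space M. epochs \<omega> \<in> a} * prob {\<omega> \<in> space M. \<omega> \<in> b}"
      by simp
  qed
  moreover have "emeasure (distr M (seqs \<Otimes>\<^sub>M marks) (\<lambda>\<omega>. (epochs \<omega>, \<omega>))) ?E
    = emeasure M {\<omega> \<in> space M. \<forall>k\<in>{1..J}. queue_count J T Sig X k t \<omega> = n k}"
    by (subst emeasure_distr[OF measurable_Pair[OF measurable_epochs id] sets_population_event])
      (auto intro!: arg_cong[where f="emeasure M"] simp: space_pair_measure space_PiM queue_count_eq_population)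
  moreover have "emeasure (distr M seqs epochs \<Otimes>\<^sub>M ?D) ?E = (\<integral>\<^sup>+x. emeasure ?D (Pair x -` ?E) \<partial>distr M seqs epochs)"
    by (rule D.emeasure_pair_measure_alt) (use sets_population_event in \<open>simp cong: sets_pair_measure_cong\<close>)
  moreover have "\<dots> = (\<integral>\<^sup>+x. population_law t n x \<partial>distr M seqs epochs)"
  proof (rule nn_integral_cong)
    fix x assume "x \<in> space (distr M seqs epochs)"
    have "Pair x -` ?E = {\<omega> \<in> space M. \<forall>k\<in>{1..J}. population t x k \<omega> = n k}"
      by (auto simp: space_pair_measure space_PiM)
    moreover have "\<dots> \<in> sets marks"
      by (rule borel_measurable_marks_section(2)[where P="\<lambda>x \<omega>. \<forall>k\<in>{1..J}. population t x k \<omega> = n k", OF sets_population_event])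
        (simp add: space_PiM)
    ultimately show "emeasure ?D (Pair x -` ?E) = population_law t n x"
      by (simp add: emeasure_marks population_law_def)
  qed
  moreover have "\<dots> = (\<integral>\<^sup>+\<omega>. population_law t n (epochs \<omega>) \<partial>M)"
    by (rule nn_integral_distr) measurable
  ultimately show ?thesis by simp
qed

text \<open>
  Batch 1 stands for the generic batch, see \<open>batch_law_eq\<close>.
\<close>
definition batch_law :: "(nat \<Rightarrow> nat) \<Rightarrow> real \<Rightarrow> ennreal" where
  "batch_law c s = emeasure M {\<omega> \<in> space M. \<forall>k\<in>{1..J}. batch_queue_count J Sig X 1 k s \<omega> = c k}"

lemma batch_law_eq:
  assumes "1 \<le> i" "0 \<le> s"
  shows "emeasure M {\<omega> \<in> space M. \<forall>k\<in>{1..J}. batch_queue_count J Sig X i k s \<omega> = c k} = batch_law c s"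
proof -
  have "prob {\<omega> \<in> space M. \<forall>k\<in>{1..J}. batch_queue_count J Sig X i k s \<omega> = c k}
    = measure (distr M vecs (\<lambda>\<omega>. \<lambda>k\<in>{1..J}. batch_queue_count J Sig X i k s \<omega>)) {y \<in> space vecs. \<forall>k\<in>{1..J}. y k = c k}"
    if "1 \<le> i" for i
    by (rule prob_vector_eq[OF measurable_batch_queue_count_M[OF that assms(2)]])
  from this[OF assms(1)] this[of 1] show ?thesis
    unfolding batch_law_def emeasure_eq_measure distr_batch_count_vector[OF assms(1) order_refl assms(2)] by simp
qed

lemma borel_measurable_batch_law: "(\<lambda>\<tau>. batch_law c (max 0 (t - \<tau>))) \<in> borel_measurable borel"
  unfolding batch_law_def
proof (rule borel_measurable_marks_section(1))
  have [measurable]: "(\<lambda>y. batch_queue_count J Sig X 1 k (max 0 (t - fst y)) (snd y)) \<in> measurable (borel \<Otimes>\<^sub>M marks) (count_space UNIV)" for k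
    by (rule measurable_batch_queue_count[OF batch_sources_subset]) auto
  show "{y \<in> space (borel \<Otimes>\<^sub>M marks). \<forall>k\<in>{1..J}. batch_queue_count J Sig X 1 k (max 0 (t - fst y)) (snd y) = c k} \<in> sets (borel \<Otimes>\<^sub>M marks)"
    by measurable
qed

section \<open>The recursion\<close>

text \<open>
  The other batches are independent of batch \<open>Suc j\<close>.  After renumbering by \<open>gap j\<close> they are the
  population for the epochs without entry \<open>j\<close>, except that some batch numbers are shifted by one;
  by \<open>prob_sum_batch_counts\<close> this does not change the law.
\<close>
lemma emeasure_batch_and_rest:
  assumes w: "\<omega> \<in> space M" and j: "j < arrival_count T t \<omega>"
  defines "Y \<equiv> \<lambda>i k. batch_queue_count J Sig X (Suc i) k (max 0 (t - real_of_ereal (epochs \<omega> i)))"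
  shows "emeasure M {\<omega>' \<in> space M. (\<forall>k\<in>{1..J}. Y j k \<omega>' = c k) \<and>
        (\<forall>k\<in>{1..J}. (\<Sum>i\<in>{..<arrival_count T t \<omega>} - {j}. Y i k \<omega>') = d k)}
    = batch_law c (max 0 (t - real_of_ereal (epochs \<omega> j))) * population_law t d (epochs \<omega> \<circ> gap j)"
proof -
  let ?A = "arrival_count T t \<omega>"
  let ?B = "sources - {Arrivals} - batch_sources (Suc j)"
  have BJ: "batch_sources (Suc j) \<subseteq> sources" using batch_sources_subset[of "Suc j"] by auto
  have [measurable]: "Y j k \<in> measurable (source_space (batch_sources (Suc j))) (count_space UNIV)" for k
    unfolding Y_def by (rule measurable_batch_queue_count_fixed) auto
  have "{\<omega>' \<in> space (source_space (batch_sources (Suc j))). \<forall>k\<in>{1..J}. Y j k \<omega>' = c k} \<in> sets (source_space (batch_sources (Suc j)))"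
    by measurable
  then have E: "{\<omega>' \<in> space M. \<forall>k\<in>{1..J}. Y j k \<omega>' = c k} \<in> sets (source_space (batch_sources (Suc j)))" by simp
  have Yi: "Y i k \<in> measurable (source_space ?B) (count_space UNIV)" if "i \<noteq> j" for i k
    unfolding Y_def
  proof (rule measurable_batch_queue_count[where g="\<lambda>\<omega>. \<omega>"])
    show "batch_sources (Suc i) \<subseteq> ?B"
      using batch_sources_subset[of "Suc i"] batch_sources_disjoint[of "Suc i" "Suc j"] that by auto
  qed auto
  have [measurable]: "(\<lambda>\<omega>'. \<Sum>i\<in>{..<?A} - {j}. Y i k \<omega>') \<in> measurable (source_space ?B) (count_space UNIV)" for k
    by (intro measurable_count_space_sum Yi) auto
  have "{\<omega>' \<in> space (source_space ?B). \<forall>k\<in>{1..J}. (\<Sum>i\<in>{..<?A} - {j}. Y i k \<omega>') = d k} \<in> sets (source_space ?B)"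
    by measurable
  then have F: "{\<omega>' \<in> space M. \<forall>k\<in>{1..J}. (\<Sum>i\<in>{..<?A} - {j}. Y i k \<omega>') = d k} \<in> sets (source_space ?B)" by simp
  have "prob ({\<omega>' \<in> space M. \<forall>k\<in>{1..J}. Y j k \<omega>' = c k} \<inter> {\<omega>' \<in> space M. \<forall>k\<in>{1..J}. (\<Sum>i\<in>{..<?A} - {j}. Y i k \<omega>') = d k})
    = prob {\<omega>' \<in> space M. \<forall>k\<in>{1..J}. Y j k \<omega>' = c k} * prob {\<omega>' \<in> space M. \<forall>k\<in>{1..J}. (\<Sum>i\<in>{..<?A} - {j}. Y i k \<omega>') = d k}"
    by (rule prob_Int_sources[OF BJ _ _ E F]) auto
  also have "{\<omega>' \<in> space M. \<forall>k\<in>{1..J}. Y j k \<omega>' = c k} \<inter> {\<omega>' \<in> space M. \<forall>k\<in>{1..J}. (\<Sum>i\<in>{..<?A} - {j}. Y i k \<omega>') = d k}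
    = {\<omega>' \<in> space M. (\<forall>k\<in>{1..J}. Y j k \<omega>' = c k) \<and> (\<forall>k\<in>{1..J}. (\<Sum>i\<in>{..<?A} - {j}. Y i k \<omega>') = d k)}"
    by auto
  finally have "emeasure M {\<omega>' \<in> space M. (\<forall>k\<in>{1..J}. Y j k \<omega>' = c k) \<and> (\<forall>k\<in>{1..J}. (\<Sum>i\<in>{..<?A} - {j}. Y i k \<omega>') = d k)}
    = emeasure M {\<omega>' \<in> space M. \<forall>k\<in>{1..J}. Y j k \<omega>' = c k} * emeasure M {\<omega>' \<in> space M. \<forall>k\<in>{1..J}. (\<Sum>i\<in>{..<?A} - {j}. Y i k \<omega>') = d k}"
    by (simp only: emeasure_eq_measure ennreal_mult measure_nonneg)
  moreover have "emeasure M {\<omega>' \<in> space M. \<forall>k\<in>{1..J}. Y j k \<omega>' = c k} = batch_law c (max 0 (t - real_of_ereal (epochs \<omega> j)))"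
    unfolding Y_def by (rule batch_law_eq) auto
  moreover have "emeasure M {\<omega>' \<in> space M. \<forall>k\<in>{1..J}. (\<Sum>i\<in>{..<?A} - {j}. Y i k \<omega>') = d k} = population_law t d (epochs \<omega> \<circ> gap j)"
  proof -
    have bij: "bij_betw (gap j) {..<?A - 1} ({..<?A} - {j})" using j by (rule bij_betw_gap)
    let ?s = "\<lambda>i. max 0 (t - real_of_ereal (epochs \<omega> (gap j i)))"
    have "(\<Sum>i\<in>{..<?A} - {j}. Y i k \<omega>') = (\<Sum>i<?A - 1. batch_queue_count J Sig X (Suc (gap j i)) k (?s i) \<omega>')" for k \<omega>'
      by (subst sum.reindex_bij_betw[OF bij, symmetric]) (simp add: Y_def)
    moreover have "inj_on (\<lambda>i. Suc (gap j i)) {..<?A - 1}"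
      using bij by (auto simp: bij_betw_def inj_on_def)
    then have "prob {\<omega>' \<in> space M. \<forall>k\<in>{1..J}. (\<Sum>i<?A - 1. batch_queue_count J Sig X (Suc (gap j i)) k (?s i) \<omega>') = d k}
      = prob {\<omega>' \<in> space M. \<forall>k\<in>{1..J}. (\<Sum>i<?A - 1. batch_queue_count J Sig X (Suc i) k (?s i) \<omega>') = d k}"
      by (rule prob_sum_batch_counts) auto
    ultimately show ?thesis
      unfolding population_law_def population_def Least_greater_removed_epochs[OF w j] emeasure_eq_measure by simp
  qed
  ultimately show ?thesis by simp
qed

text \<open>
  The decomposition of \<open>n v\<close> according to batches, for fixed epochs.  On the event that the population is \<open>n\<close>,
  exactly one \<open>c\<close> is the contribution of batch \<open>Suc j\<close>, and the sum over \<open>j\<close> of its entries \<open>c v\<close> is \<open>n v\<close>; off this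
  event no term survives because \<open>c \<le> n\<close> forces the contributions to add up to \<open>n\<close>.
\<close>
lemma population_law_recursion:
  assumes w: "\<omega> \<in> space M" and v: "v \<in> {1..J}"
  shows "of_nat (n v) * population_law t n (epochs \<omega>)
    = (\<Sum>j<arrival_count T t \<omega>. \<Sum>c\<in>(\<Pi>\<^sub>E k\<in>{1..J}. {0..n k}). of_nat (c v) *
        (batch_law c (max 0 (t - real_of_ereal (epochs \<omega> j))) * population_law t (\<lambda>k. n k - c k) (epochs \<omega> \<circ> gap j)))"
proof -
  let ?A = "arrival_count T t \<omega>"
  let ?Box = "\<Pi>\<^sub>E k\<in>{1..J}. {0..n k}"
  define Y where "Y = (\<lambda>i k. batch_queue_count J Sig X (Suc i) k (max 0 (t - real_of_ereal (epochs \<omega> i))))"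
  have fin: "finite ?Box" by (intro finite_PiE) auto
  define E where "E = (\<lambda>j c. {\<omega>' \<in> space M. (\<forall>k\<in>{1..J}. Y j k \<omega>' = c k) \<and>
        (\<forall>k\<in>{1..J}. (\<Sum>i\<in>{..<?A} - {j}. Y i k \<omega>') = n k - c k)})"
  have [measurable]: "Y i k \<in> measurable M (count_space UNIV)" for i k
    unfolding Y_def by (rule measurable_batch_queue_count_M) auto
  have [measurable]: "(\<lambda>\<omega>'. \<Sum>i\<in>I. Y i k \<omega>') \<in> measurable M (count_space UNIV)" for I k
    by (rule measurable_count_space_sum) auto
  have E [measurable]: "E j c \<in> events" for j c unfolding E_def by measurable
  let ?P = "{\<omega>' \<in> space M. \<forall>k\<in>{1..J}. (\<Sum>i<?A. Y i k \<omega>') = n k}"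
  have P [measurable]: "?P \<in> events" by measurable
  have split: "(\<Sum>i<?A. Y i k \<omega>') = Y j k \<omega>' + (\<Sum>i\<in>{..<?A} - {j}. Y i k \<omega>')" if "j < ?A" for j k \<omega>'
    using that by (subst sum.remove[of _ j]) auto
  have pointwise: "of_nat (n v) * indicator ?P \<omega>' = (\<Sum>j<?A. \<Sum>c\<in>?Box. of_nat (c v) * (indicator (E j c) \<omega>' :: ennreal))"
    if w': "\<omega>' \<in> space M" for \<omega>'
  proof (cases "\<omega>' \<in> ?P")
    case True
    then have sum: "(\<Sum>i<?A. Y i k \<omega>') = n k" if "k \<in> {1..J}" for k using that by blast
    have "(\<Sum>c\<in>?Box. of_nat (c v) * (indicator (E j c) \<omega>' :: ennreal)) = of_nat (Y j v \<omega>')" if j: "j < ?A" for j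
    proof -
      let ?c = "\<lambda>k\<in>{1..J}. Y j k \<omega>'"
      have "?c \<in> ?Box" using sum split[OF j] by (force simp: PiE_def Pi_def)
      moreover have "\<omega>' \<in> E j c \<longleftrightarrow> c = ?c" if "c \<in> ?Box" for c
      proof
        assume "\<omega>' \<in> E j c"
        then show "c = ?c" using that by (intro PiE_ext[OF that \<open>?c \<in> ?Box\<close>]) (simp add: E_def)
      next
        assume c: "c = ?c"
        have "(\<Sum>i\<in>{..<?A} - {j}. Y i k \<omega>') = n k - Y j k \<omega>'" if "k \<in> {1..J}" for k
          using sum[OF that] split[OF j, of k \<omega>'] by simp
        then show "\<omega>' \<in> E j c" using w' by (simp add: E_def c)
      qed
      then have "(\<Sum>c\<in>?Box. of_nat (c v) * (indicator (E j c) \<omega>' :: ennreal)) = (\<Sum>c\<in>?Box. if c = ?c then of_nat (c v) else 0)"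
        by (intro sum.cong refl) (simp add: indicator_def)
      ultimately show ?thesis using fin v by simp
    qed
    then have "(\<Sum>j<?A. \<Sum>c\<in>?Box. of_nat (c v) * (indicator (E j c) \<omega>' :: ennreal)) = of_nat (\<Sum>j<?A. Y j v \<omega>')"
      by simp
    then show ?thesis using True sum[OF v] by simp
  next
    case False
    have "\<omega>' \<notin> E j c" if "j < ?A" "c \<in> ?Box" for j c
    proof
      assume "\<omega>' \<in> E j c"
      then have "(\<Sum>i<?A. Y i k \<omega>') = n k" if "k \<in> {1..J}" for k
        using PiE_mem[OF \<open>c \<in> ?Box\<close> that] split[OF \<open>j < ?A\<close>, of k \<omega>'] that by (simp add: E_def)
      then show False using False w' by simp
    qed
    then show ?thesis using False by (simp add: indicator_def)
  qed
  have "of_nat (n v) * population_law t n (epochs \<omega>) = of_nat (n v) * emeasure M ?P"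
    unfolding population_law_def population_def Least_greater_epochs[OF w] Y_def ..
  also have "\<dots> = (\<integral>\<^sup>+\<omega>'. of_nat (n v) * indicator ?P \<omega>' \<partial>M)"
    using P by (simp add: nn_integral_cmult)
  also have "\<dots> = (\<integral>\<^sup>+\<omega>'. (\<Sum>j<?A. \<Sum>c\<in>?Box. of_nat (c v) * indicator (E j c) \<omega>') \<partial>M)"
    by (intro nn_integral_cong pointwise)
  also have "\<dots> = (\<Sum>j<?A. \<Sum>c\<in>?Box. of_nat (c v) * emeasure M (E j c))"
    using E by (simp add: nn_integral_sum nn_integral_cmult)
  also have "\<dots> = (\<Sum>j<?A. \<Sum>c\<in>?Box. of_nat (c v) *
        (batch_law c (max 0 (t - real_of_ereal (epochs \<omega> j))) * population_law t (\<lambda>k. n k - c k) (epochs \<omega> \<circ> gap j)))"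
    unfolding E_def Y_def by (intro sum.cong refl arg_cong2[where f="(*)"] emeasure_batch_and_rest[OF w]) auto
  finally show ?thesis .
qed

text \<open>
  Integrating \<open>population_law_recursion\<close> over the epochs, the Mecke formula separates the epoch of the
  chosen batch from the remaining ones.
\<close>
lemma emeasure_queue_count_recursion:
  assumes t: "0 \<le> t" and v: "v \<in> {1..J}"
  shows "of_nat (n v) * emeasure M {\<omega> \<in> space M. \<forall>k\<in>{1..J}. queue_count J T Sig X k t \<omega> = n k}
    = (\<Sum>c\<in>(\<Pi>\<^sub>E k\<in>{1..J}. {0..n k}). of_nat (c v) *
        ((\<integral>\<^sup>+\<tau>. ennreal (indicator {0..t} \<tau> * lam \<tau>) * batch_law c (max 0 (t - \<tau>)) \<partial>lborel)
         * emeasure M {\<omega> \<in> space M. \<forall>k\<in>{1..J}. queue_count J T Sig X k t \<omega> = n k - c k}))"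
proof -
  let ?Box = "\<Pi>\<^sub>E k\<in>{1..J}. {0..n k}"
  let ?F = "\<lambda>c \<omega>. \<Sum>j<arrival_count T t \<omega>. batch_law c (max 0 (t - real_of_ereal (epochs \<omega> j))) * population_law t (\<lambda>k. n k - c k) (epochs \<omega> \<circ> gap j)"
  note [measurable] = borel_measurable_batch_law
  have [measurable]: "?F c \<in> borel_measurable M" for c
  proof -
    have [measurable]: "(\<lambda>\<omega>. epochs \<omega> \<circ> gap j) \<in> measurable M seqs" for j
      unfolding comp_def by (rule measurable_PiM_single') auto
    have [measurable]: "(\<lambda>\<omega>. batch_law c (max 0 (t - real_of_ereal (epochs \<omega> j)))) \<in> borel_measurable M" for j
      by (rule measurable_compose[OF _ borel_measurable_batch_law]) measurable
    show ?thesis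
      by (rule measurable_compose_countable[where f="\<lambda>m \<omega>. \<Sum>j<m. batch_law c (max 0 (t - real_of_ereal (epochs \<omega> j))) * population_law t (\<lambda>k. n k - c k) (epochs \<omega> \<circ> gap j)"])
        measurable
  qed
  have "of_nat (n v) * emeasure M {\<omega> \<in> space M. \<forall>k\<in>{1..J}. queue_count J T Sig X k t \<omega> = n k}
    = (\<integral>\<^sup>+\<omega>. of_nat (n v) * population_law t n (epochs \<omega>) \<partial>M)"
    unfolding emeasure_queue_count by (subst nn_integral_cmult) auto
  also have "\<dots> = (\<integral>\<^sup>+\<omega>. (\<Sum>c\<in>?Box. of_nat (c v) * ?F c \<omega>) \<partial>M)"
  proof (rule nn_integral_cong)
    fix \<omega> assume "\<omega> \<in> space M"
    from population_law_recursion[OF this v, of n t]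
    show "of_nat (n v) * population_law t n (epochs \<omega>) = (\<Sum>c\<in>?Box. of_nat (c v) * ?F c \<omega>)"
      by (subst (asm) sum.swap) (simp add: sum_distrib_left)
  qed
  also have "\<dots> = (\<Sum>c\<in>?Box. of_nat (c v) * (\<integral>\<^sup>+\<omega>. ?F c \<omega> \<partial>M))"
    by (simp add: nn_integral_sum nn_integral_cmult)
  also have "\<dots> = (\<Sum>c\<in>?Box. of_nat (c v) *
        ((\<integral>\<^sup>+\<tau>. ennreal (indicator {0..t} \<tau> * lam \<tau>) * batch_law c (max 0 (t - \<tau>)) \<partial>lborel)
         * emeasure M {\<omega> \<in> space M. \<forall>k\<in>{1..J}. queue_count J T Sig X k t \<omega> = n k - c k}))"
    unfolding emeasure_queue_count
    by (intro sum.cong refl arg_cong2[where f="(*)"] mecke_formula[OF t borel_measurable_batch_law borel_measurable_population_law])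
  finally show ?thesis .
qed

lemma nn_integral_batch_law:
  assumes t: "0 \<le> t" and m: "1 \<le> m"
  shows "(\<integral>\<^sup>+\<tau>. ennreal (indicator {0..t} \<tau> * lam \<tau>) * batch_law c (max 0 (t - \<tau>)) \<partial>lborel)
    = ennreal (LBINT \<tau>:{0..t}. lam \<tau> * \<P>(\<omega> in M. \<forall>k\<in>{1..J}. batch_queue_count J Sig X m k (t - \<tau>) \<omega> = c k))"
proof -
  let ?p = "\<lambda>\<tau>. enn2real (batch_law c (max 0 (t - \<tau>)))"
  have law: "batch_law c s = ennreal (enn2real (batch_law c s))" "enn2real (batch_law c s) \<le> 1" for s
    by (simp_all add: batch_law_def emeasure_eq_measure)
  have [measurable]: "?p \<in> borel_measurable borel"
    using borel_measurable_batch_law by measurable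
  have int: "integrable lborel (\<lambda>\<tau>. indicator {0..t} \<tau> * lam \<tau> * ?p \<tau>)"
  proof (rule Bochner_Integration.integrable_bound)
    show "integrable lborel (\<lambda>\<tau>. indicator {0..t} \<tau> * lam \<tau>)"
      using rate_locally_integrable[OF t] by (simp add: set_integrable_def)
    show "AE \<tau> in lborel. norm (indicator {0..t} \<tau> * lam \<tau> * ?p \<tau>) \<le> norm (indicator {0..t} \<tau> * lam \<tau>)"
      using law(2) by (intro AE_I2) (auto simp: abs_mult intro!: mult_left_le)
  qed measurable
  have "(\<integral>\<^sup>+\<tau>. ennreal (indicator {0..t} \<tau> * lam \<tau>) * batch_law c (max 0 (t - \<tau>)) \<partial>lborel)
    = (\<integral>\<^sup>+\<tau>. ennreal (indicator {0..t} \<tau> * lam \<tau> * ?p \<tau>) \<partial>lborel)"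
    by (subst law(1)) (simp add: ennreal_mult rate_indicator_nonneg)
  also have "\<dots> = ennreal (\<integral>\<tau>. indicator {0..t} \<tau> * lam \<tau> * ?p \<tau> \<partial>lborel)"
    using int by (intro nn_integral_eq_integral AE_I2 mult_nonneg_nonneg rate_indicator_nonneg) auto
  also have "(\<integral>\<tau>. indicator {0..t} \<tau> * lam \<tau> * ?p \<tau> \<partial>lborel)
    = (LBINT \<tau>:{0..t}. lam \<tau> * \<P>(\<omega> in M. \<forall>k\<in>{1..J}. batch_queue_count J Sig X m k (t - \<tau>) \<omega> = c k))"
    unfolding set_lebesgue_integral_def
  proof (rule Bochner_Integration.integral_cong[OF refl])
    fix \<tau>
    show "indicator {0..t} \<tau> * lam \<tau> * ?p \<tau>
      = indicator {0..t} \<tau> *\<^sub>R (lam \<tau> * \<P>(\<omega> in M. \<forall>k\<in>{1..J}. batch_queue_count J Sig X m k (t - \<tau>) \<omega> = c k))"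
    proof (cases "\<tau> \<in> {0..t}")
      case True
      then show ?thesis
        using batch_law_eq[OF m, of "t - \<tau>" c, symmetric] by (simp add: emeasure_eq_measure max_def)
    qed simp
  qed
  finally show ?thesis .
qed

text \<open>
  The recursion for an arbitrary vector of length \<open>J\<close>, without zero padding.
\<close>
lemma prob_queue_count_recursion:
  assumes t: "0 \<le> t" and v: "v \<in> {1..J}" and n: "1 \<le> n v" and m: "1 \<le> m"
  shows "\<P>(\<omega> in M. \<forall>k\<in>{1..J}. queue_count J T Sig X k t \<omega> = n k)
    = (\<Sum>c\<in>(\<Pi>\<^sub>E k\<in>{1..J}. {0..n k}). real (c v) / real (n v)
        * \<P>(\<omega> in M. \<forall>k\<in>{1..J}. queue_count J T Sig X k t \<omega> = n k - c k)
        * (LBINT \<tau>:{0..t}. lam \<tau> * \<P>(\<omega> in M. \<forall>k\<in>{1..J}. batch_queue_count J Sig X m k (t - \<tau>) \<omega> = c k)))"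
proof -
  let ?N = "\<lambda>n. \<P>(\<omega> in M. \<forall>k\<in>{1..J}. queue_count J T Sig X k t \<omega> = n k)"
  let ?I = "\<lambda>c. LBINT \<tau>:{0..t}. lam \<tau> * \<P>(\<omega> in M. \<forall>k\<in>{1..J}. batch_queue_count J Sig X m k (t - \<tau>) \<omega> = c k)"
  let ?Box = "\<Pi>\<^sub>E k\<in>{1..J}. {0..n k}"
  have I: "0 \<le> ?I c" for c
    unfolding set_lebesgue_integral_def
    by (intro Bochner_Integration.integral_nonneg) (auto simp: indicator_def rate_nonneg)
  have "ennreal (real (n v) * ?N n) = of_nat (n v) * emeasure M {\<omega> \<in> space M. \<forall>k\<in>{1..J}. queue_count J T Sig X k t \<omega> = n k}"
    by (simp add: emeasure_eq_measure ennreal_mult ennreal_of_nat_eq_real_of_nat)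
  also have "\<dots> = (\<Sum>c\<in>?Box. ennreal (real (c v) * (?I c * ?N (\<lambda>k. n k - c k))))"
    unfolding emeasure_queue_count_recursion[OF t v] nn_integral_batch_law[OF t m]
    using I by (simp add: emeasure_eq_measure ennreal_mult ennreal_of_nat_eq_real_of_nat)
  also have "\<dots> = ennreal (\<Sum>c\<in>?Box. real (c v) * (?I c * ?N (\<lambda>k. n k - c k)))"
    using I by (intro sum_ennreal) auto
  finally have "real (n v) * ?N n = (\<Sum>c\<in>?Box. real (c v) * (?I c * ?N (\<lambda>k. n k - c k)))"
    using I by (subst (asm) ennreal_inj) (auto intro!: sum_nonneg)
  then have "?N n = (\<Sum>c\<in>?Box. real (c v) * (?I c * ?N (\<lambda>k. n k - c k))) / real (n v)"
    using n by (simp add: field_simps)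
  also have "\<dots> = (\<Sum>c\<in>?Box. real (c v) / real (n v) * ?N (\<lambda>k. n k - c k) * ?I c)"
    by (simp add: sum_divide_distrib mult_ac)
  finally show ?thesis .
qed

end

theorem theorem5p1:
  fixes M :: "'a measure" and lam :: "real \<Rightarrow> real" and T :: "nat \<Rightarrow> 'a \<Rightarrow> ereal"
    and J :: nat and S :: "nat \<Rightarrow> 'a \<Rightarrow> nat" and Sig :: "nat \<Rightarrow> nat \<Rightarrow> 'a \<Rightarrow> nat"
    and X :: "nat \<Rightarrow> nat \<Rightarrow> nat \<Rightarrow> real \<Rightarrow> 'a \<Rightarrow> nat" and q :: "nat \<Rightarrow> nat \<Rightarrow> real \<Rightarrow> real"
    and t :: real and v m :: nat and n :: "nat \<Rightarrow> nat"
  assumes "infinite_server_network M lam T J S Sig X q"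
    and "0 \<le> t" and "v \<in> {2..J}" and "1 \<le> n v" and "1 \<le> m"
  shows "\<P>(\<omega> in M. \<forall>k\<in>{1..J}. queue_count J T Sig X k t \<omega> = zero_pad v n k) =
    (\<Sum>i \<in> (\<Pi>\<^sub>E k\<in>{1..v}. if k = v then {1..n v} else {0..n k}).
       real (i v) / real (n v)
       * \<P>(\<omega> in M. \<forall>k\<in>{1..J}. queue_count J T Sig X k t \<omega> = zero_pad v (\<lambda>k. n k - i k) k)
       * (LBINT \<tau>:{0..t}. lam \<tau>
            * \<P>(\<omega> in M. \<forall>k\<in>{1..J}. batch_queue_count J Sig X m k (t - \<tau>) \<omega> = zero_pad v i k)))"
proof -
  interpret infinite_server_network M lam T J S Sig X q by fact
  let ?N = "\<lambda>n. \<P>(\<omega> in M. \<forall>k\<in>{1..J}. queue_count J T Sig X k t \<omega> = n k)"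
  let ?I = "\<lambda>c. LBINT \<tau>:{0..t}. lam \<tau> * \<P>(\<omega> in M. \<forall>k\<in>{1..J}. batch_queue_count J Sig X m k (t - \<tau>) \<omega> = c k)"
  let ?Box = "\<Pi>\<^sub>E k\<in>{1..J}. {0..zero_pad v n k}"
  let ?box = "\<Pi>\<^sub>E k\<in>{1..v}. if k = v then {1..n v} else {0..n k}"
  have v: "v \<in> {1..J}" "2 \<le> v" "v \<le> J" using assms(3) by auto
  have N: "?N a = ?N b" if "\<And>k. k \<in> {1..J} \<Longrightarrow> a k = b k" for a b
    using that by (intro arg_cong[where f=prob]) auto
  have I: "?I a = ?I b" if "\<And>k. k \<in> {1..J} \<Longrightarrow> a k = b k" for a b
  proof -
    have "(\<forall>k\<in>{1..J}. batch_queue_count J Sig X m k s \<omega> = a k) \<longleftrightarrow> (\<forall>k\<in>{1..J}. batch_queue_count J Sig X m k s \<omega> = b k)" for s \<omega>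
      using that by auto
    then show ?thesis by simp
  qed
  have "?N (zero_pad v n) = (\<Sum>c\<in>?Box. real (c v) / real (zero_pad v n v) * ?N (\<lambda>k. zero_pad v n k - c k) * ?I c)"
    by (rule prob_queue_count_recursion) (use assms v in \<open>auto simp: zero_pad_def\<close>)
  \<comment> \<open>The terms with \<open>c v = 0\<close> vanish because of the factor \<open>c v\<close>, which explains the range of \<open>i v\<close>.\<close>
  also have "\<dots> = (\<Sum>c\<in>{c \<in> ?Box. c v \<noteq> 0}. real (c v) / real (n v) * ?N (\<lambda>k. zero_pad v n k - c k) * ?I c)"
    by (rule sum.mono_neutral_cong_right) (auto simp: zero_pad_def intro!: finite_PiE)
  also have "\<dots> = (\<Sum>i\<in>?box. real (i v) / real (n v) * ?N (zero_pad v (\<lambda>k. n k - i k)) * ?I (zero_pad v i))"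
  proof (rule sum.reindex_bij_witness[where i="\<lambda>i. restrict (zero_pad v i) {1..J}" and j="\<lambda>c. restrict c {1..v}"])
    fix c assume "c \<in> {c \<in> ?Box. c v \<noteq> 0}"
    then have c: "c \<in> extensional {1..J}" "\<And>k. k \<in> {1..J} \<Longrightarrow> c k \<le> zero_pad v n k" "c v \<noteq> 0"
      by (auto simp: PiE_def)
    have eq: "zero_pad v (restrict c {1..v}) k = c k" if "k \<in> {1..J}" for k
      using c(2)[OF that] that by (auto simp: zero_pad_def split: if_splits)
    show "restrict (zero_pad v (restrict c {1..v})) {1..J} = c"
      using eq c(1) by (intro extensionalityI[of _ "{1..J}"]) auto
    have "c k \<le> n k" if "k \<in> {1..v}" for k
      using c(2)[of k] that v by (simp add: zero_pad_def)
    then show "restrict c {1..v} \<in> ?box"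
      using c(3) by auto
    have "?N (zero_pad v (\<lambda>k. n k - restrict c {1..v} k)) = ?N (\<lambda>k. zero_pad v n k - c k)"
      by (rule N) (auto simp: zero_pad_def)
    moreover have "?I (zero_pad v (restrict c {1..v})) = ?I c" by (rule I) (rule eq)
    ultimately show "real (restrict c {1..v} v) / real (n v) * ?N (zero_pad v (\<lambda>k. n k - restrict c {1..v} k)) * ?I (zero_pad v (restrict c {1..v}))
      = real (c v) / real (n v) * ?N (\<lambda>k. zero_pad v n k - c k) * ?I c"
      using v by simp
  next
    fix i assume "i \<in> ?box"
    then have i: "i \<in> extensional {1..v}" "\<And>k. k \<in> {1..v} \<Longrightarrow> i k \<le> n k" "1 \<le> i v"
      using v by (auto simp: PiE_def Pi_def split: if_splits)
    show "restrict (restrict (zero_pad v i) {1..J}) {1..v} = i"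
      using v by (intro extensionalityI[OF _ i(1)]) (auto simp: zero_pad_def)
    show "restrict (zero_pad v i) {1..J} \<in> {c \<in> ?Box. c v \<noteq> 0}"
      using i v by (auto simp: zero_pad_def)
  qed
  finally show ?thesis .
qed

end
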